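(* Let $G$ be a graph with $n$ vertices, $m$ edges and $C_3$ triangles. Then any algorithm $\mathcal{A}$ that computes a multiplicative approximation of $C_3$ must perform $\Omega\left(\min\left\{m, \frac{m^{3/2}}{C_3}\right\}\right)$ degree, neighbor, or pair queries (in expectation). This lower bound holds even if $\mathcal{A}$ is additionally allowed to perform random edge queries, each of which returns an edge of $G$ sampled uniformly at random.
   Context: Query model (general graph model): the graph has vertex set $[n]$, known to the algorithm, and each vertex's neighbor set is ordered by an arbitrary fixed bijection with $[\deg(v)]$. Allowed queries: degree query (returns $\deg(v)$), neighbor query $\mathrm{nbr}_i(v)$ (returns the $i$-th neighbor of $v$ if $i \le \deg(v)$, a special symbol otherwise), pair query (returns whether $\{u,v\}$ is an edge). A (randomized) algorithm computes a multiplicative $(1\pm\varepsilon)$-approximation of a graph parameter $c(G)$ if for every input graph its output $\hat c$ satisfies $\Pr[|\hat c - c(G)| \le \varepsilon c(G)] \ge 2/3$; "a multiplicative approximation" refers to such an approximation for any fixed approximation factor. Query complexity is the expected number of queries on the worst input; the lower bound is as a function of the parameters $n, m, C_3$ of the input graphs. *)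

theory Defs
  imports "HOL-Probability.Probability"
begin

text \<open>A simple graph with vertex set \<open>{1..n}\<close> is given by its set of edges, each edge
  being a two-element set of vertices.\<close>

definition simple_graph :: "nat \<Rightarrow> nat set set \<Rightarrow> bool" where
  "simple_graph n E \<longleftrightarrow> (\<forall>e\<in>E. e \<subseteq> {1..n} \<and> card e = 2)"

definition neighbours :: "nat set set \<Rightarrow> nat \<Rightarrow> nat set" where
  "neighbours E v = {u. {u, v} \<in> E}"

definition deg :: "nat set set \<Rightarrow> nat \<Rightarrow> nat" where
  "deg E v = card (neighbours E v)"

definition triangles :: "nat set set \<Rightarrow> nat set set" where
  "triangles E = {T. card T = 3 \<and> (\<forall>u\<in>T. \<forall>v\<in>T. u \<noteq> v \<longrightarrow> {u, v} \<in> E)}"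

definition triangle_count :: "nat set set \<Rightarrow> nat" where
  "triangle_count E = card (triangles E)"

text \<open>An input consists of a graph and, for each vertex \<open>v\<close>, an ordering \<open>nbr v\<close> of its
  neighbours.\<close>

definition valid_input :: "nat \<Rightarrow> nat set set \<Rightarrow> (nat \<Rightarrow> nat \<Rightarrow> nat) \<Rightarrow> bool" where
  "valid_input n E nbr \<longleftrightarrow>
     simple_graph n E \<and> (\<forall>v\<in>{1..n}. bij_betw (nbr v) {1..deg E v} (neighbours E v))"

datatype query =
    Degree_Query nat
  | Neighbour_Query nat nat
  | Pair_Query nat nat
  | Random_Edge_Query

datatype answer =
    Degree_Answer nat
  | Neighbour_Answer "nat option"
  | Pair_Answer bool
  | Edge_Answer "nat set option"

text \<open>\<open>Neighbour_Query v i\<close> asks for the \<open>i\<close>-th neighbour of \<open>v\<close>, counting from 1. The value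
  \<open>None\<close> is the special symbol; a random edge query returns it only on the edgeless graph.
  A query mentioning a number that is not a vertex is answered as if that number were an
  isolated vertex, so it reveals nothing.\<close>

fun answer_pmf :: "nat set set \<Rightarrow> (nat \<Rightarrow> nat \<Rightarrow> nat) \<Rightarrow> query \<Rightarrow> answer pmf" where
  "answer_pmf E nbr (Degree_Query v) = return_pmf (Degree_Answer (deg E v))"
| "answer_pmf E nbr (Neighbour_Query v i) =
     return_pmf (Neighbour_Answer (if i \<in> {1..deg E v} then Some (nbr v i) else None))"
| "answer_pmf E nbr (Pair_Query u v) = return_pmf (Pair_Answer ({u, v} \<in> E))"
| "answer_pmf E nbr Random_Edge_Query =
     (if E = {} then return_pmf (Edge_Answer None)
      else map_pmf (\<lambda>e. Edge_Answer (Some e)) (pmf_of_set E))"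

text \<open>A randomized adaptive algorithm chooses, at random depending on everything it has seen
  so far, either its next query or its output. There is no bound on the number of queries,
  and an algorithm need not halt. The number \<open>n\<close> of vertices is known to the algorithm: an
  algorithm of this type is meant for one value of \<open>n\<close>, and may be a different one for each \<open>n\<close>.\<close>

type_synonym transcript = "(query \<times> answer) list"

datatype action = Ask query | Output real

type_synonym algorithm = "transcript \<Rightarrow> action pmf"

datatype state = Running transcript | Halted transcript real

fun step :: "algorithm \<Rightarrow> nat set set \<Rightarrow> (nat \<Rightarrow> nat \<Rightarrow> nat) \<Rightarrow> state \<Rightarrow> state pmf" where
  "step A E nbr (Running h) =
     bind_pmf (A h) (\<lambda>act. case act of
         Ask q \<Rightarrow> map_pmf (\<lambda>a. Running (h @ [(q, a)])) (answer_pmf E nbr q)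
       | Output x \<Rightarrow> return_pmf (Halted h x))"
| "step A E nbr (Halted h x) = return_pmf (Halted h x)"

primrec run :: "algorithm \<Rightarrow> nat set set \<Rightarrow> (nat \<Rightarrow> nat \<Rightarrow> nat) \<Rightarrow> nat \<Rightarrow> state pmf" where
  "run A E nbr 0 = return_pmf (Running [])"
| "run A E nbr (Suc k) = bind_pmf (run A E nbr k) (step A E nbr)"

fun num_queries :: "state \<Rightarrow> nat" where
  "num_queries (Running h) = length h"
| "num_queries (Halted h x) = length h"

text \<open>Both quantities below are suprema (limits) of sequences that are nondecreasing in the
  number \<open>k\<close> of steps: halted states are never left, and transcripts only grow. By monotone
  convergence they are the probability that the algorithm halts with an output in \<open>S\<close>, and the
  expectation of the total number of queries, which is infinite if the algorithm fails to
  halt with positive probability.\<close>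

definition output_prob ::
    "algorithm \<Rightarrow> nat set set \<Rightarrow> (nat \<Rightarrow> nat \<Rightarrow> nat) \<Rightarrow> real set \<Rightarrow> real" where
  "output_prob A E nbr S =
     (SUP k. measure_pmf.prob (run A E nbr k) {s. \<exists>h. \<exists>x\<in>S. s = Halted h x})"

definition expected_queries ::
    "algorithm \<Rightarrow> nat set set \<Rightarrow> (nat \<Rightarrow> nat \<Rightarrow> nat) \<Rightarrow> ennreal" where
  "expected_queries A E nbr =
     (SUP k. \<integral>\<^sup>+ s. of_nat (num_queries s) \<partial>measure_pmf (run A E nbr k))"

definition computes_approximation ::
    "nat \<Rightarrow> real \<Rightarrow> (nat set set \<Rightarrow> real) \<Rightarrow> algorithm \<Rightarrow> bool" where
  "computes_approximation n \<epsilon> c A \<longleftrightarrow>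
     (\<forall>E nbr. valid_input n E nbr \<longrightarrow>
        output_prob A E nbr {x. \<bar>x - c E\<bar> \<le> \<epsilon> * c E} \<ge> 2 / 3)"

end

theory Submission
  imports Defs
begin

text \<open>Exchanging edges \<open>{a, b}\<close>, \<open>{c, d}\<close> for nonedges \<open>{a, c}\<close>, \<open>{b, d}\<close> preserves all
  degrees, and creates about \<open>\<surd>m\<close> triangles if \<open>a\<close> and \<open>c\<close> have that many common neighbours.
  A suitable graph with \<open>m\<close> edges and \<open>t\<close> triangles admits a packing of order \<open>m\<close> such
  exchanges with pairwise disjoint sets of changed pairs. Split the packing into groups of
  \<open>K\<close> exchanges, where \<open>K\<close> is of order \<open>max 1 (t/\<surd>m)\<close>, so that performing one group
  multiplies the number of triangles by a large constant. Every answer, also a random edge,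
  reveals at most one of the order \<open>m/K\<close> groups, while a correct algorithm has to hit each
  group with probability bounded from below. Hence the expected number of queries on the
  unmodified graph is at least of order \<open>m/K\<close>.

  If \<open>m\<close> is of order \<open>n\<^sup>2\<close> and \<open>t\<close> is small compared with \<open>n\<^sup>3\<close>, every graph with these
  parameters is suitable, since it has order \<open>n\<^sup>4\<close> cycles of length four and few of them have
  a chord. If \<open>m\<close> is small compared with \<open>n\<^sup>2\<close>, a graph containing an induced complete bipartite
  graph of order \<open>\<surd>m\<close> is constructed. In all other cases the bound is a constant, and
  comparison with the edgeless graph suffices.\<close>

section \<open>Runs that see no difference between two inputs\<close>

fun transcript_of :: "state \<Rightarrow> transcript" where
  "transcript_of (Running h) = h"
| "transcript_of (Halted h x) = h"

definition touched :: "(query \<Rightarrow> answer \<Rightarrow> bool) \<Rightarrow> state \<Rightarrow> bool" where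
  "touched \<tau> s \<longleftrightarrow> (\<exists>(q, a) \<in> set (transcript_of s). \<tau> q a)"

text \<open>Mapping a distribution along \<open>hide P\<close> lumps the event \<open>P\<close> into
  \<open>None\<close>. Equality of two such images says that the distributions agree outside
  \<open>P\<close>, without naming a coupling.\<close>

definition hide :: "('a \<Rightarrow> bool) \<Rightarrow> 'a \<Rightarrow> 'a option" where
  "hide P x = (if P x then None else Some x)"

text \<open>Transcripts only grow, so a touched state stays touched.\<close>

lemma map_hide_step_touched:
  assumes "touched \<tau> s"
  shows "map_pmf (hide (touched \<tau>)) (step A E nbr s) = return_pmf None"
proof -
  have "touched \<tau> s'" if "s' \<in> set_pmf (step A E nbr s)" for s'
  proof (cases s)
    case (Running h)
    from assms obtain q a where qa: "(q, a) \<in> set h" "\<tau> q a"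
      by (auto simp: Running touched_def)
    have "set h \<subseteq> set (transcript_of s')"
    proof -
      from that obtain act where act: "act \<in> set_pmf (A h)"
        "s' \<in> set_pmf (case act of
            Ask q \<Rightarrow> map_pmf (\<lambda>a. Running (h @ [(q, a)])) (answer_pmf E nbr q)
          | Output x \<Rightarrow> return_pmf (Halted h x))"
        by (auto simp: Running)
      from act(2) show ?thesis by (cases act) auto
    qed
    with qa show ?thesis by (auto simp: touched_def)
  qed (use that assms in auto)
  then have "map_pmf (hide (touched \<tau>)) (step A E nbr s)
      = map_pmf (\<lambda>_. None) (step A E nbr s)"
    by (intro map_pmf_cong) (auto simp: hide_def)
  then show ?thesis by simp
qed

text \<open>The next action depends on the transcript alone, so the two inputs differ only in the
  answer, and answers that do not touch have equal probabilities.\<close>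

lemma map_hide_step_untouched:
  assumes "\<not> touched \<tau> s"
    and "\<And>q. map_pmf (hide (\<tau> q)) (answer_pmf E nbr q) = map_pmf (hide (\<tau> q)) (answer_pmf E' nbr' q)"
  shows "map_pmf (hide (touched \<tau>)) (step A E nbr s) = map_pmf (hide (touched \<tau>)) (step A E' nbr' s)"
proof (cases s)
  case (Running h)
  \<comment> \<open>From an untouched transcript the new state is touched exactly when the new
    answer is, so hiding states factors through hiding answers.\<close>
  have eq: "map_pmf (hide (touched \<tau>)) (map_pmf (\<lambda>a. Running (h @ [(q, a)])) p)
      = map_pmf (map_option (\<lambda>a. Running (h @ [(q, a)]))) (map_pmf (hide (\<tau> q)) p)" for q p
    unfolding pmf.map_comp using assms(1) Running
    by (intro map_pmf_cong) (auto simp: hide_def touched_def)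
  show ?thesis
    unfolding Running step.simps map_bind_pmf
    by (intro bind_pmf_cong refl) (auto simp: eq assms(2) split: action.splits)
qed simp

lemma map_hide_run:
  assumes "\<And>q. map_pmf (hide (\<tau> q)) (answer_pmf E nbr q) = map_pmf (hide (\<tau> q)) (answer_pmf E' nbr' q)"
  shows "map_pmf (hide (touched \<tau>)) (run A E nbr k) = map_pmf (hide (touched \<tau>)) (run A E' nbr' k)"
proof (induction k)
  case (Suc k)
  \<comment> \<open>After hiding, the run is still a Markov chain: \<open>f\<close> is its
    transition, with \<open>None\<close> absorbing.\<close>
  define f where "f E nbr z = (case z of None \<Rightarrow> return_pmf None
      | Some s \<Rightarrow> map_pmf (hide (touched \<tau>)) (step A E nbr s))" for E nbr z
  have run_Suc: "map_pmf (hide (touched \<tau>)) (run A E nbr (Suc k))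
      = bind_pmf (map_pmf (hide (touched \<tau>)) (run A E nbr k)) (f E nbr)" for E nbr
    unfolding run.simps map_bind_pmf bind_map_pmf
    by (intro bind_pmf_cong refl) (auto simp: hide_def f_def map_hide_step_touched)
  have "bind_pmf (map_pmf (hide (touched \<tau>)) p) (f E nbr)
      = bind_pmf (map_pmf (hide (touched \<tau>)) p) (f E' nbr')" for p
    using map_hide_step_untouched[OF _ assms]
    by (intro bind_pmf_cong refl) (auto simp: f_def hide_def split: if_splits)
  then show ?case unfolding run_Suc Suc.IH by simp
qed simp

section \<open>Halting probabilities and expected numbers of queries\<close>

abbreviation halted_in :: "real set \<Rightarrow> state set" where
  "halted_in S \<equiv> {s. \<exists>h. \<exists>x\<in>S. s = Halted h x}"

lemma prob_halted_in_mono: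
  "incseq (\<lambda>k. measure_pmf.prob (run A E nbr k) (halted_in S))"
proof (rule incseq_SucI)
  fix k
  have "emeasure (run A E nbr k) (halted_in S)
      = (\<integral>\<^sup>+ s. indicator (halted_in S) s \<partial>run A E nbr k)"
    by simp
  also have "\<dots> \<le> (\<integral>\<^sup>+ s. emeasure (step A E nbr s) (halted_in S) \<partial>run A E nbr k)"
    by (intro nn_integral_mono) (auto simp: indicator_def)
  also have "\<dots> = emeasure (run A E nbr (Suc k)) (halted_in S)"
    by simp
  finally show "measure_pmf.prob (run A E nbr k) (halted_in S)
      \<le> measure_pmf.prob (run A E nbr (Suc k)) (halted_in S)"
    by (simp add: measure_pmf.emeasure_eq_measure)
qed

lemma eventually_prob_halted_in:
  assumes "c < output_prob A E nbr S"
  shows "\<forall>\<^sub>F k in sequentially. c < measure_pmf.prob (run A E nbr k) (halted_in S)"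
proof -
  have "(\<lambda>k. measure_pmf.prob (run A E nbr k) (halted_in S)) \<longlonglongrightarrow> output_prob A E nbr S"
    unfolding output_prob_def
    by (intro LIMSEQ_incseq_SUP prob_halted_in_mono bdd_aboveI[of _ 1]) auto
  then show ?thesis using assms by (rule order_tendstoD)
qed

text \<open>Halting in \<open>S'\<close> or being touched is an event of hidden states, so it is
  equally likely on both inputs. On \<open>E\<close>, halting in \<open>S\<close> and halting in
  \<open>S'\<close> exclude each other. The touching probability refers to the run on
  \<open>E\<close> only, so that it can later be summed over many modifications.\<close>

lemma prob_halted_in_le_touched:
  assumes eq: "\<And>q. map_pmf (hide (\<tau> q)) (answer_pmf E nbr q) = map_pmf (hide (\<tau> q)) (answer_pmf E' nbr' q)"
    and "S \<inter> S' = {}"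
  shows "measure_pmf.prob (run A E nbr k) (halted_in S) + measure_pmf.prob (run A E' nbr' k) (halted_in S')
    \<le> 1 + measure_pmf.prob (run A E nbr k) {s. touched \<tau> s}"
proof -
  let ?X = "{None} \<union> Some ` (halted_in S')"
  have "measure_pmf.prob (run A E' nbr' k) (halted_in S')
      \<le> measure_pmf.prob (run A E' nbr' k) (hide (touched \<tau>) -` ?X)"
    by (intro measure_pmf.finite_measure_mono) (auto simp: hide_def)
  also have "\<dots> = measure_pmf.prob (map_pmf (hide (touched \<tau>)) (run A E' nbr' k)) ?X"
    by simp
  also have "\<dots> = measure_pmf.prob (map_pmf (hide (touched \<tau>)) (run A E nbr k)) ?X"
    using map_hide_run[OF eq] by simp
  also have "\<dots> = measure_pmf.prob (run A E nbr k) (hide (touched \<tau>) -` ?X)"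
    by simp
  also have "\<dots> \<le> measure_pmf.prob (run A E nbr k) ({s. touched \<tau> s} \<union> halted_in S')"
    by (intro measure_pmf.finite_measure_mono) (auto simp: hide_def split: if_splits)
  also have "\<dots> \<le> measure_pmf.prob (run A E nbr k) {s. touched \<tau> s}
      + measure_pmf.prob (run A E nbr k) (halted_in S')"
    by (intro measure_Un_le) auto
  finally have "measure_pmf.prob (run A E' nbr' k) (halted_in S') \<le> \<dots>" .
  moreover have "measure_pmf.prob (run A E nbr k) (halted_in S) + measure_pmf.prob (run A E nbr k) (halted_in S')
      = measure_pmf.prob (run A E nbr k) (halted_in S \<union> halted_in S')"
    using assms(2) by (intro measure_pmf.finite_measure_Union[symmetric]) auto
  moreover have "\<dots> \<le> 1" by simp
  ultimately show ?thesis by linarith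
qed

text \<open>By uniqueness each transcript entry accounts for at most one index.\<close>

lemma card_touched_le_num_queries:
  assumes "finite J" and "\<And>q a i j. i \<in> J \<Longrightarrow> j \<in> J \<Longrightarrow> \<tau> i q a \<Longrightarrow> \<tau> j q a \<Longrightarrow> i = j"
  shows "card {j\<in>J. touched (\<tau> j) s} \<le> num_queries s"
proof -
  let ?h = "transcript_of s"
  have "{j\<in>J. touched (\<tau> j) s} \<subseteq> (\<Union>p\<in>set ?h. {j\<in>J. \<tau> j (fst p) (snd p)})"
    unfolding touched_def case_prod_beta by blast
  then have "card {j\<in>J. touched (\<tau> j) s} \<le> card (\<Union>p\<in>set ?h. {j\<in>J. \<tau> j (fst p) (snd p)})"
    using assms(1) by (intro card_mono) auto
  also have "\<dots> \<le> (\<Sum>p\<in>set ?h. card {j\<in>J. \<tau> j (fst p) (snd p)})"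
    by (intro card_UN_le) simp
  also have "\<dots> \<le> (\<Sum>p\<in>set ?h. 1)"
    using assms by (intro sum_mono) (auto simp: card_le_Suc0_iff_eq)
  also have "\<dots> \<le> num_queries s"
    using card_length[of ?h] by (cases s) auto
  finally show ?thesis .
qed

text \<open>No output is acceptable for both \<open>E\<close> and \<open>F j\<close>, so telling
  them apart needs an answer that touches \<open>j\<close>. On the run for \<open>E\<close> this has
  constant probability for each \<open>j\<close>, and one query serves at most one \<open>j\<close>;
  linearity of expectation sums this up.\<close>

lemma expected_queries_ge:
  assumes A: "computes_approximation n \<epsilon> c A"
    and E: "valid_input n E nbr"
    and "finite J"
    and F: "\<And>j. j \<in> J \<Longrightarrow> valid_input n (F j) (nbr' j)"
    and disj: "\<And>j x. j \<in> J \<Longrightarrow> \<bar>x - c E\<bar> \<le> \<epsilon> * c E \<Longrightarrow> \<not> \<bar>x - c (F j)\<bar> \<le> \<epsilon> * c (F j)"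
    and eq: "\<And>j q. j \<in> J \<Longrightarrow> map_pmf (hide (\<tau> j q)) (answer_pmf E nbr q)
        = map_pmf (hide (\<tau> j q)) (answer_pmf (F j) (nbr' j) q)"
    and uniq: "\<And>q a i j. i \<in> J \<Longrightarrow> j \<in> J \<Longrightarrow> \<tau> i q a \<Longrightarrow> \<tau> j q a \<Longrightarrow> i = j"
  shows "ennreal (real (card J) / 6) \<le> expected_queries A E nbr"
proof -
  let ?S = "\<lambda>E. {x. \<bar>x - c E\<bar> \<le> \<epsilon> * c E}"
  \<comment> \<open>Success probabilities are limits of value at least 2/3. After finitely many
    steps they exceed 7/12, and \<open>7/12 + 7/12 - 1 = 1/6\<close>.\<close>
  have ev: "\<forall>\<^sub>F k in sequentially. 7 / 12 < measure_pmf.prob (run A E nbr k) (halted_in (?S E))"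
    if "valid_input n E nbr" for E nbr
    using A that by (intro eventually_prob_halted_in) (force simp: computes_approximation_def)
  \<comment> \<open>\<open>J\<close> is finite, so a single \<open>k\<close> serves all inputs at
    once.\<close>
  have "\<forall>\<^sub>F k in sequentially. \<forall>j\<in>J. 7 / 12 < measure_pmf.prob (run A (F j) (nbr' j) k) (halted_in (?S (F j)))"
    using F by (intro eventually_ball_finite \<open>finite J\<close> ballI ev)
  with ev[OF E] have "\<forall>\<^sub>F k in sequentially. 7 / 12 < measure_pmf.prob (run A E nbr k) (halted_in (?S E))
      \<and> (\<forall>j\<in>J. 7 / 12 < measure_pmf.prob (run A (F j) (nbr' j) k) (halted_in (?S (F j))))"
    by (rule eventually_conj)
  then obtain k where k: "7 / 12 < measure_pmf.prob (run A E nbr k) (halted_in (?S E))"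
    "\<And>j. j \<in> J \<Longrightarrow> 7 / 12 < measure_pmf.prob (run A (F j) (nbr' j) k) (halted_in (?S (F j)))"
    by (auto dest: eventually_happens)
  let ?p = "run A E nbr k"
  have "1 / 6 \<le> measure_pmf.prob ?p {s. touched (\<tau> j) s}" if j: "j \<in> J" for j
  proof -
    have "?S E \<inter> ?S (F j) = {}" using disj[OF j] by blast
    from prob_halted_in_le_touched[OF eq[OF j] this, of A k] k(1) k(2)[OF j]
    show ?thesis by argo
  qed
  then have "real (card J) / 6 \<le> (\<Sum>j\<in>J. measure_pmf.prob ?p {s. touched (\<tau> j) s})"
    using sum_bounded_below[of J "1 / 6 :: real"] by simp
  then have "ennreal (real (card J) / 6) \<le> (\<Sum>j\<in>J. emeasure ?p {s. touched (\<tau> j) s})"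
    by (simp add: measure_pmf.emeasure_eq_measure sum_ennreal ennreal_leI)
  also have "\<dots> = (\<Sum>j\<in>J. \<integral>\<^sup>+ s. indicator {s. touched (\<tau> j) s} s \<partial>?p)"
    by simp
  also have "\<dots> = (\<integral>\<^sup>+ s. (\<Sum>j\<in>J. indicator {s. touched (\<tau> j) s} s) \<partial>?p)"
    by (intro nn_integral_sum[symmetric]) auto
  also have "\<dots> = (\<integral>\<^sup>+ s. of_nat (card {j\<in>J. touched (\<tau> j) s}) \<partial>?p)"
    using \<open>finite J\<close>
    by (intro nn_integral_cong) (simp add: indicator_def sum.If_cases Int_def)
  also have "\<dots> \<le> (\<integral>\<^sup>+ s. of_nat (num_queries s) \<partial>?p)"
    using card_touched_le_num_queries[of J \<tau>] \<open>finite J\<close> uniq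
    by (intro nn_integral_mono) (auto simp: ennreal_of_nat_eq_real_of_nat intro!: ennreal_leI)
  also have "\<dots> \<le> expected_queries A E nbr"
    unfolding expected_queries_def by (intro SUP_upper) simp
  finally show ?thesis .
qed

section \<open>Graphs with equal degrees\<close>

lemma simple_graphD:
  assumes "simple_graph n E" "{u, v} \<in> E"
  shows "u \<in> {1..n}" "v \<in> {1..n}" "u \<noteq> v"
  using assms by (auto simp: simple_graph_def)

lemma simple_graph_finite:
  assumes "simple_graph n E"
  shows "finite E"
proof (rule finite_subset)
  show "E \<subseteq> Pow {1..n}" using assms by (auto simp: simple_graph_def)
qed simp

lemma finite_neighbours:
  assumes "simple_graph n E"
  shows "finite (neighbours E v)"
proof (rule finite_subset)
  show "neighbours E v \<subseteq> {1..n}"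
    using assms simple_graphD by (auto simp: neighbours_def)
qed simp

lemma finite_triangles:
  assumes "simple_graph n E"
  shows "finite (triangles E)"
proof (rule finite_subset)
  show "triangles E \<subseteq> Pow {1..n}"
  proof (clarify)
    fix T u assume T: "T \<in> triangles E" "u \<in> T"
    then have "\<not> T \<subseteq> {u}"
      using card_mono[of "{u}" T] by (auto simp: triangles_def)
    then obtain v where "v \<in> T" "u \<noteq> v" by blast
    with T have "{u, v} \<in> E" by (simp add: triangles_def)
    from simple_graphD(1)[OF assms this] show "u \<in> {1..n}" .
  qed
qed simp

lemma valid_input_exists:
  assumes "simple_graph n E"
  shows "\<exists>nbr. valid_input n E nbr"
proof -
  have "\<exists>f. bij_betw f {1..deg E v} (neighbours E v)" for v
    using finite_neighbours[OF assms, of v] by (simp add: deg_def bij_betw_iff_card)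
  then show ?thesis
    using assms unfolding valid_input_def by metis
qed

text \<open>Carries a neighbour ordering or a uniform edge over to the modified graph while moving
  only what was changed.\<close>

lemma bij_betw_fixing_Int_exists:
  assumes "finite A" "finite B" "card A = card B"
  shows "\<exists>f. bij_betw f A B \<and> (\<forall>x\<in>A \<inter> B. f x = x)"
proof -
  have "card (A - B) = card (B - A)"
    using assms by (simp add: card_Diff_subset_Int Int_commute)
  then obtain g where g: "bij_betw g (A - B) (B - A)"
    using assms by (metis bij_betw_iff_card finite_Diff)
  define f where "f x = (if x \<in> B then x else g x)" for x
  have "bij_betw f (A - B) (B - A)"
    using g by (subst bij_betw_cong[of _ f g]) (auto simp: f_def)
  moreover have "bij_betw f (A \<inter> B) (A \<inter> B)"
    by (subst bij_betw_cong[of _ f id]) (auto simp: f_def)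
  ultimately have "bij_betw f ((A - B) \<union> (A \<inter> B)) ((B - A) \<union> (A \<inter> B))"
    by (rule bij_betw_combine) auto
  moreover have "(A - B) \<union> (A \<inter> B) = A" "(B - A) \<union> (A \<inter> B) = B" by auto
  ultimately show ?thesis by (auto simp: f_def)
qed

text \<open>\<open>D\<close> collects the pairs whose status may differ between two graphs. A pair
  query about \<open>D\<close> reveals it whatever the answer; degrees and \<open>None\<close> never
  do, as degrees will be preserved.\<close>

fun reveals :: "nat set set \<Rightarrow> query \<Rightarrow> answer \<Rightarrow> bool" where
  "reveals D (Neighbour_Query v i) (Neighbour_Answer (Some u)) \<longleftrightarrow> {v, u} \<in> D"
| "reveals D (Pair_Query u v) a \<longleftrightarrow> {u, v} \<in> D"
| "reveals D Random_Edge_Query (Edge_Answer (Some e)) \<longleftrightarrow> e \<in> D"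
| "reveals D _ _ \<longleftrightarrow> False"

lemma reveals_disjoint:
  assumes "reveals D q a" "reveals D' q a"
  shows "D \<inter> D' \<noteq> {}"
  using assms by (induction D q a rule: reveals.induct) auto

text \<open>Each new neighbour takes the position of a lost one, and a random edge of
  \<open>E\<close> is matched with one of \<open>E'\<close> by a bijection fixing the common edges.
  Hence answers that differ involve a pair in \<open>D\<close> on both sides.\<close>

lemma same_degrees_indistinguishable:
  assumes valid: "valid_input n E nbr" and E': "simple_graph n E'"
    and deg: "\<And>v. deg E' v = deg E v" and card: "card E' = card E"
    and D: "(E - E') \<union> (E' - E) \<subseteq> D"
  obtains nbr' where "valid_input n E' nbr'"
    and "\<And>q. map_pmf (hide (reveals D q)) (answer_pmf E nbr q)
          = map_pmf (hide (reveals D q)) (answer_pmf E' nbr' q)"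
proof -
  have E: "simple_graph n E" and nbr: "\<And>v. v \<in> {1..n} \<Longrightarrow> bij_betw (nbr v) {1..deg E v} (neighbours E v)"
    using valid by (auto simp: valid_input_def)
  have "\<exists>f. bij_betw f (neighbours E v) (neighbours E' v)
      \<and> (\<forall>u\<in>neighbours E v \<inter> neighbours E' v. f u = u)" for v
    using finite_neighbours[OF E, of v] finite_neighbours[OF E', of v] deg[of v]
    by (intro bij_betw_fixing_Int_exists) (auto simp: deg_def)
  then obtain f where f: "\<And>v. bij_betw (f v) (neighbours E v) (neighbours E' v)"
    "\<And>v u. u \<in> neighbours E v \<Longrightarrow> u \<in> neighbours E' v \<Longrightarrow> f v u = u"
    by (metis IntI)
  obtain g where g: "bij_betw g E E'" "\<And>e. e \<in> E \<Longrightarrow> e \<in> E' \<Longrightarrow> g e = e"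
    using bij_betw_fixing_Int_exists[OF simple_graph_finite[OF E] simple_graph_finite[OF E'] card[symmetric]]
    by blast
  define nbr' where "nbr' v i = f v (nbr v i)" for v i
  have "valid_input n E' nbr'"
    unfolding valid_input_def
  proof (intro conjI ballI E')
    fix v assume "v \<in> {1..n}"
    from bij_betw_trans[OF nbr[OF this] f(1)[of v]]
    show "bij_betw (nbr' v) {1..deg E' v} (neighbours E' v)"
      unfolding deg nbr'_def comp_def .
  qed
  moreover have "map_pmf (hide (reveals D q)) (answer_pmf E nbr q)
      = map_pmf (hide (reveals D q)) (answer_pmf E' nbr' q)" for q
  proof (cases q)
    case (Neighbour_Query v i)
    show ?thesis
    proof (cases "i \<in> {1..deg E v}")
      case True
      then have "neighbours E v \<noteq> {}" by (auto simp: deg_def)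
      then have "v \<in> {1..n}"
        using simple_graphD[OF E] by (auto simp: neighbours_def)
      from bij_betwE[OF nbr[OF this]] True have u: "nbr v i \<in> neighbours E v" by blast
      from bij_betwE[OF f(1)] this have u': "nbr' v i \<in> neighbours E' v"
        unfolding nbr'_def by blast
      show ?thesis
      proof (cases "nbr v i \<in> neighbours E' v")
        case True
        with f(2)[OF u] have "nbr' v i = nbr v i" by (simp add: nbr'_def)
        then show ?thesis by (simp add: Neighbour_Query deg)
      next
        case False
        \<comment> \<open>\<open>f v\<close> is injective and fixes common neighbours, so a lost
          neighbour is replaced by a new one, and both answers are hidden.\<close>
        have "nbr' v i \<notin> neighbours E v"
        proof
          assume *: "nbr' v i \<in> neighbours E v"
          with u' f(2) have "f v (nbr' v i) = f v (nbr v i)" by (simp add: nbr'_def)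
          with f(1)[of v] * u have "nbr' v i = nbr v i"
            by (auto simp: bij_betw_def inj_on_def)
          with False u' show False by simp
        qed
        then have "{nbr' v i, v} \<in> D" "{nbr v i, v} \<in> D"
          using u u' False D by (auto simp: neighbours_def)
        then show ?thesis
          by (simp add: Neighbour_Query deg hide_def insert_commute)
      qed
    qed (auto simp: Neighbour_Query deg)
  next
    case (Pair_Query u v)
    then show ?thesis using D by (auto simp: hide_def)
  next
    case Random_Edge_Query
    have "E = {} \<longleftrightarrow> E' = {}"
      using card simple_graph_finite[OF E] simple_graph_finite[OF E'] by auto
    moreover have "map_pmf (hide (reveals D q)) (answer_pmf E nbr q)
      = map_pmf (hide (reveals D q)) (answer_pmf E' nbr' q)" if "E \<noteq> {}" "E' \<noteq> {}"
    proof -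
      have "pmf_of_set E' = map_pmf g (pmf_of_set E)"
        using g(1) that simple_graph_finite[OF E]
        by (subst map_pmf_of_set_inj) (auto simp: bij_betw_def)
      moreover have "hide (reveals D q) (Edge_Answer (Some e))
          = hide (reveals D q) (Edge_Answer (Some (g e)))" if "e \<in> E" for e
      proof (cases "e \<in> E'")
        case True
        then show ?thesis using g(2) that by simp
      next
        case False
        have "g e \<in> E'" using bij_betwE[OF g(1)] that by blast
        moreover have "g e \<notin> E"
        proof
          assume *: "g e \<in> E"
          with \<open>g e \<in> E'\<close> g(2) have "g (g e) = g e" by simp
          with g(1) * that have "g e = e" by (auto simp: bij_betw_def inj_on_def)
          with False \<open>g e \<in> E'\<close> show False by simp
        qed
        ultimately show ?thesis using D that False by (auto simp: hide_def Random_Edge_Query)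
      qed
      ultimately show ?thesis
        using that set_pmf_of_set[OF that(1) simple_graph_finite[OF E]]
        unfolding Random_Edge_Query
        by (simp add: pmf.map_comp comp_def) (rule map_pmf_cong, simp_all)
    qed
    ultimately show ?thesis by (cases "E = {}") (auto simp: Random_Edge_Query)
  qed (simp add: deg)
  ultimately show ?thesis by (rule that)
qed

section \<open>Counting exchanges\<close>

definition common_nbrs :: "nat set set \<Rightarrow> nat set \<Rightarrow> nat \<Rightarrow> nat \<Rightarrow> nat set" where
  "common_nbrs E V a c = {w\<in>V. {a, w} \<in> E \<and> {c, w} \<in> E}"

lemma common_nbrs_subset: "common_nbrs E V a c \<subseteq> V"
  by (auto simp: common_nbrs_def)

text \<open>By Cauchy-Schwarz there are at least \<open>\<alpha>^2 * N^3\<close> triples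
  \<open>(a, v, c)\<close> with \<open>v\<close> adjacent to both ends, where
  \<open>N = card V\<close>. Pairs of codegree below the threshold account for at most half of this
  number, and every other pair for at most \<open>N\<close>.\<close>

lemma many_pairs_with_large_codegree:
  fixes \<alpha> :: real
  assumes "finite V" "0 \<le> \<alpha>"
    and dense: "\<alpha> * real (card V) ^ 2 \<le> (\<Sum>v\<in>V. real (card {u\<in>V. {u, v} \<in> E}))"
  shows "\<alpha>\<^sup>2 / 2 * real (card V) ^ 2
    \<le> real (card {(a, c) \<in> V \<times> V. \<alpha>\<^sup>2 / 2 * real (card V) \<le> real (card (common_nbrs E V a c))})"
    (is "?\<delta> * ?N ^ 2 \<le> real (card ?P)")
proof (cases "V = {}")
  case False
  then have N: "0 < ?N" using \<open>finite V\<close> by (simp add: card_gt_0_iff)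
  define e where "e u w = (of_bool ({u, w} \<in> E) :: real)" for u w
  have d: "real (card {u\<in>V. {u, v} \<in> E}) = (\<Sum>u\<in>V. e u v)" for v
    using \<open>finite V\<close> by (simp add: e_def of_bool_def sum.If_cases Int_def)
  have codeg: "real (card (common_nbrs E V a c)) = (\<Sum>w\<in>V. e a w * e c w)" for a c
  proof -
    have "(\<Sum>w\<in>V. e a w * e c w) = (\<Sum>w\<in>V. if {a, w} \<in> E \<and> {c, w} \<in> E then 1 else 0)"
      by (intro sum.cong) (auto simp: e_def)
    then show ?thesis
      using \<open>finite V\<close> by (simp add: sum.If_cases Int_def common_nbrs_def)
  qed
  have "(\<alpha> * ?N ^ 2) ^ 2 \<le> (\<Sum>v\<in>V. \<Sum>u\<in>V. e u v) ^ 2"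
    using dense \<open>0 \<le> \<alpha>\<close> by (intro power_mono) (auto simp: d)
  also have "\<dots> \<le> (\<Sum>v\<in>V. (\<Sum>u\<in>V. e u v) ^ 2) * ?N"
    by (rule sum_squared_le_sum_of_squares)
  finally have "(\<alpha>\<^sup>2 * ?N ^ 3) * ?N \<le> (\<Sum>v\<in>V. (\<Sum>u\<in>V. e u v) ^ 2) * ?N"
    by (simp add: power2_eq_square power3_eq_cube ac_simps)
  then have "\<alpha>\<^sup>2 * ?N ^ 3 \<le> (\<Sum>v\<in>V. (\<Sum>u\<in>V. e u v) ^ 2)"
    using N by simp
  also have "\<dots> = (\<Sum>v\<in>V. \<Sum>a\<in>V. \<Sum>c\<in>V. e a v * e c v)"
    by (simp add: power2_eq_square sum_product)
  also have "\<dots> = (\<Sum>a\<in>V. \<Sum>v\<in>V. \<Sum>c\<in>V. e a v * e c v)"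
    by (rule sum.swap)
  also have "\<dots> = (\<Sum>a\<in>V. \<Sum>c\<in>V. \<Sum>v\<in>V. e a v * e c v)"
    by (intro sum.cong refl sum.swap)
  also have "\<dots> = (\<Sum>(a, c)\<in>V \<times> V. real (card (common_nbrs E V a c)))"
    unfolding codeg by (rule sum.cartesian_product)
  also have "\<dots> \<le> (\<Sum>(a, c)\<in>V \<times> V. ?\<delta> * ?N + (if (a, c) \<in> ?P then ?N else 0))"
  proof (intro sum_mono, clarify)
    fix a c assume "a \<in> V" "c \<in> V"
    then have P: "(a, c) \<in> ?P \<longleftrightarrow> ?\<delta> * ?N \<le> real (card (common_nbrs E V a c))" by simp
    have "real (card (common_nbrs E V a c)) \<le> ?N"
      using common_nbrs_subset \<open>finite V\<close> by (simp add: card_mono)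
    moreover have "0 \<le> ?\<delta> * ?N" by simp
    ultimately show "real (card (common_nbrs E V a c)) \<le> ?\<delta> * ?N + (if (a, c) \<in> ?P then ?N else 0)"
      unfolding P by argo
  qed
  also have "\<dots> = ?\<delta> * ?N ^ 3 + real (card ?P) * ?N"
  proof -
    have "(V \<times> V) \<inter> {x. x \<in> ?P} = ?P" by auto
    then show ?thesis
      using \<open>finite V\<close>
      by (simp add: case_prod_beta sum.distrib sum.If_cases card_cartesian_product
          power3_eq_cube del: mem_Collect_eq)
  qed
  finally have "(?\<delta> * ?N ^ 2) * ?N \<le> real (card ?P) * ?N"
    by (simp add: power2_eq_square power3_eq_cube field_simps)
  then show ?thesis using N by simp
qed simp

text \<open>The quadruple \<open>((a, c), (b, d))\<close> stands for the exchange of the edges \<open>{a, b}\<close>, \<open>{c, d}\<close>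
  for the nonedges \<open>{a, c}\<close>, \<open>{b, d}\<close>, which preserves all degrees.\<close>

type_synonym exchange = "(nat \<times> nat) \<times> (nat \<times> nat)"

fun removed :: "exchange \<Rightarrow> nat set set" where
  "removed ((a, c), (b, d)) = {{a, b}, {c, d}}"

fun added :: "exchange \<Rightarrow> nat set set" where
  "added ((a, c), (b, d)) = {{a, c}, {b, d}}"

fun verts :: "exchange \<Rightarrow> nat set" where
  "verts ((a, c), (b, d)) = {a, b, c, d}"

definition changed :: "exchange \<Rightarrow> nat set set" where
  "changed q = removed q \<union> added q"

definition exchangeable :: "nat set set \<Rightarrow> exchange \<Rightarrow> bool" where
  "exchangeable E q \<longleftrightarrow> card (verts q) = 4 \<and> removed q \<subseteq> E \<and> added q \<inter> E = {}"

text \<open>With \<open>q = ((a, c), (b, d))\<close>, the last condition supplies many common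
  neighbours of \<open>a\<close> and \<open>c\<close>, each a candidate for a triangle once
  \<open>{a, c}\<close> is added.\<close>

definition good_exchanges :: "nat set set \<Rightarrow> nat set \<Rightarrow> real \<Rightarrow> exchange set" where
  "good_exchanges E V \<delta> = {q \<in> (V \<times> V) \<times> (V \<times> V). exchangeable E q
     \<and> \<delta> * real (card V) \<le> real (card (common_nbrs E V (fst (fst q)) (snd (fst q))))}"

lemma card_verts_eq_4_iff:
  "card (verts ((a, c), (b, d))) = 4 \<longleftrightarrow> distinct [a, b, c, d]"
  using card_distinct[of "[a, b, c, d]"] distinct_card[of "[a, b, c, d]"] by fastforce

definition ordered_triangles :: "nat set set \<Rightarrow> nat set \<Rightarrow> (nat \<times> nat \<times> nat) set" where
  "ordered_triangles E V
     = {(x, y, z) \<in> V \<times> V \<times> V. {x, y} \<in> E \<and> {y, z} \<in> E \<and> {x, z} \<in> E}"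

text \<open>The factor \<open>27 = 3^3\<close> counts all triples of vertices of one
  triangle.\<close>

lemma card_ordered_triangles_le:
  assumes "simple_graph n E"
  shows "card (ordered_triangles E V) \<le> 27 * triangle_count E"
proof -
  have "ordered_triangles E V \<subseteq> (\<Union>T\<in>triangles E. T \<times> T \<times> T)"
  proof (clarify)
    fix x y z assume "(x, y, z) \<in> ordered_triangles E V"
    then have xyz: "{x, y} \<in> E" "{y, z} \<in> E" "{x, z} \<in> E"
      by (auto simp: ordered_triangles_def)
    moreover from xyz have "x \<noteq> y" "y \<noteq> z" "x \<noteq> z"
      using simple_graphD(3)[OF assms] by blast+
    ultimately have "{x, y, z} \<in> triangles E"
      by (auto simp: triangles_def insert_commute)
    then show "(x, y, z) \<in> (\<Union>T\<in>triangles E. T \<times> T \<times> T)" by blast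
  qed
  moreover have "finite T" if "T \<in> triangles E" for T
    using that by (auto simp: triangles_def intro: card_ge_0_finite)
  then have "finite (\<Union>T\<in>triangles E. T \<times> T \<times> T)"
    using finite_triangles[OF assms] by simp
  ultimately have "card (ordered_triangles E V) \<le> card (\<Union>T\<in>triangles E. T \<times> T \<times> T)"
    by (intro card_mono)
  also have "\<dots> \<le> (\<Sum>T\<in>triangles E. card (T \<times> T \<times> T))"
    by (intro card_UN_le finite_triangles[OF assms])
  also have "\<dots> = (\<Sum>T\<in>triangles E. 27)"
    by (intro sum.cong) (auto simp: triangles_def card_cartesian_product)
  finally show ?thesis by (simp add: triangle_count_def)
qed

text \<open>Choosing \<open>b\<close>, \<open>d\<close> among the common neighbours of a pair
  \<open>(a, c)\<close> of large codegree gives at least \<open>\<delta>^3 * N^4\<close> closed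
  walks \<open>a, b, c, d\<close>. Such a walk is a good exchange unless it is degenerate or has a
  chord. Degenerate walks have only three free vertices, and a chord makes a triangle with one
  further free vertex; either kind costs at most a quarter of
  \<open>\<delta>^3 * N^4\<close>.\<close>

lemma card_good_exchanges_ge:
  fixes \<delta> :: real
  assumes "finite V" and E: "simple_graph n E" and "0 < \<delta>" and N: "8 \<le> \<delta> ^ 3 * real (card V)"
    and P: "\<delta> * real (card V) ^ 2
      \<le> real (card {(a, c) \<in> V \<times> V. \<delta> * real (card V) \<le> real (card (common_nbrs E V a c))})"
    and O: "real (card (ordered_triangles E V)) \<le> \<delta> ^ 3 / 8 * real (card V) ^ 3"
  shows "\<delta> ^ 3 / 2 * real (card V) ^ 4 \<le> real (card (good_exchanges E V \<delta>))"
proof -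
  let ?N = "real (card V)"
  let ?P = "{(a, c) \<in> V \<times> V. \<delta> * ?N \<le> real (card (common_nbrs E V a c))}"
  let ?D = "\<lambda>p. common_nbrs E V (fst p) (snd p)"
  let ?X = "SIGMA p:?P. ?D p \<times> ?D p"
  let ?O = "ordered_triangles E V"
  have finP: "finite ?P" by (rule finite_subset[of _ "V \<times> V"]) (use \<open>finite V\<close> in auto)
  have finD: "finite (?D p)" for p
    using finite_subset[OF common_nbrs_subset \<open>finite V\<close>] .
  have finO: "finite ?O"
    by (rule finite_subset[of _ "V \<times> V \<times> V"]) (use \<open>finite V\<close> in \<open>auto simp: ordered_triangles_def\<close>)
  have "(\<delta> * ?N ^ 2) * (\<delta> * ?N) ^ 2 \<le> real (card ?P) * (\<delta> * ?N) ^ 2"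
    using P by (intro mult_right_mono) auto
  also have "\<dots> = (\<Sum>p\<in>?P. (\<delta> * ?N) ^ 2)" by simp
  also have "\<dots> \<le> (\<Sum>p\<in>?P. real (card (?D p)) ^ 2)"
    using \<open>0 < \<delta>\<close> by (intro sum_mono power_mono) auto
  also have "\<dots> = real (card ?X)"
    using finP finD
    by (subst card_SigmaI) (auto simp: card_cartesian_product power2_eq_square)
  finally have X: "\<delta> ^ 3 * ?N ^ 4 \<le> real (card ?X)"
    by (simp add: power2_eq_square power3_eq_cube power4_eq_xxxx ac_simps)
  \<comment> \<open>\<open>?B1\<close> and \<open>?B2\<close> are the degenerate cases
    \<open>a = c\<close> and \<open>b = d\<close>; \<open>?B3\<close> and \<open>?B4\<close> are the
    chords \<open>{a, c}\<close> and \<open>{b, d}\<close>.\<close>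
  let ?B1 = "(\<lambda>(a, b, d). ((a, a), (b, d))) ` (V \<times> V \<times> V)"
  let ?B2 = "(\<lambda>(a, c, b). ((a, c), (b, b))) ` (V \<times> V \<times> V)"
  let ?B3 = "(\<lambda>((a, b, c), d). ((a, c), (b, d))) ` (?O \<times> V)"
  let ?B4 = "(\<lambda>((a, b, d), c). ((a, c), (b, d))) ` (?O \<times> V)"
  have "?X \<subseteq> good_exchanges E V \<delta> \<union> (?B1 \<union> ?B2 \<union> (?B3 \<union> ?B4))"
  proof
    fix q assume "q \<in> ?X"
    then obtain a b c d where q: "q = ((a, c), (b, d))" "a \<in> V" "c \<in> V" "b \<in> V" "d \<in> V"
      "\<delta> * ?N \<le> real (card (common_nbrs E V a c))"
      "{a, b} \<in> E" "{c, b} \<in> E" "{a, d} \<in> E" "{c, d} \<in> E"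
      by (auto simp: common_nbrs_def)
    then have dist: "a \<noteq> b" "c \<noteq> b" "a \<noteq> d" "c \<noteq> d"
      using simple_graphD(3)[OF E] by blast+
    consider "a = c" | "b = d" | "{a, c} \<in> E" | "{b, d} \<in> E"
      | "a \<noteq> c" "b \<noteq> d" "{a, c} \<notin> E" "{b, d} \<notin> E" by blast
    then show "q \<in> good_exchanges E V \<delta> \<union> (?B1 \<union> ?B2 \<union> (?B3 \<union> ?B4))"
    proof cases
      case 1
      then have "q = (\<lambda>(a, b, d). ((a, a), (b, d))) (a, b, d)" using q by simp
      then have "q \<in> ?B1" using q by blast
      then show ?thesis by blast
    next
      case 2
      then have "q = (\<lambda>(a, c, b). ((a, c), (b, b))) (a, c, b)" using q by simp
      then have "q \<in> ?B2" using q by blast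
      then show ?thesis by blast
    next
      case 3
      then have "(a, b, c) \<in> ?O" using q by (simp add: ordered_triangles_def insert_commute)
      moreover have "q = (\<lambda>((a, b, c), d). ((a, c), (b, d))) ((a, b, c), d)" using q by simp
      ultimately have "q \<in> ?B3" using q by blast
      then show ?thesis by blast
    next
      case 4
      then have "(a, b, d) \<in> ?O" using q by (simp add: ordered_triangles_def)
      moreover have "q = (\<lambda>((a, b, d), c). ((a, c), (b, d))) ((a, b, d), c)" using q by simp
      ultimately have "q \<in> ?B4" using q by blast
      then show ?thesis by blast
    next
      case 5
      then have "q \<in> good_exchanges E V \<delta>"
        using q dist card_verts_eq_4_iff[of a c b d]
        by (simp add: good_exchanges_def exchangeable_def)
      then show ?thesis by blast
    qed
  qed
  moreover have fin: "finite (good_exchanges E V \<delta>)"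
    by (rule finite_subset[of _ "(V \<times> V) \<times> (V \<times> V)"])
      (use \<open>finite V\<close> in \<open>auto simp: good_exchanges_def\<close>)
  ultimately have "card ?X \<le> card (good_exchanges E V \<delta> \<union> (?B1 \<union> ?B2 \<union> (?B3 \<union> ?B4)))"
    using \<open>finite V\<close> finO by (intro card_mono) auto
  also have "\<dots> \<le> card (good_exchanges E V \<delta>) + (card ?B1 + card ?B2 + (card ?B3 + card ?B4))"
    by (intro order.trans[OF card_Un_le] add_mono order.refl)
  also have "\<dots> \<le> card (good_exchanges E V \<delta>)
      + (card (V \<times> V \<times> V) + card (V \<times> V \<times> V) + (card (?O \<times> V) + card (?O \<times> V)))"
    using \<open>finite V\<close> finO by (intro add_mono card_image_le order.refl) auto
  also have "\<dots> = card (good_exchanges E V \<delta>) + (2 * card V ^ 3 + 2 * (card ?O * card V))"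
    unfolding card_cartesian_product power3_eq_cube by simp
  finally have "real (card ?X) \<le> real (card (good_exchanges E V \<delta>)) + (2 * ?N ^ 3 + 2 * (real (card ?O) * ?N))"
    using of_nat_mono[where 'a = real] by fastforce
  moreover have "2 * (real (card ?O) * ?N) \<le> \<delta> ^ 3 / 4 * ?N ^ 4"
    using mult_right_mono[OF O, of "2 * ?N"] by (simp add: power3_eq_cube power4_eq_xxxx ac_simps)
  moreover have "2 * ?N ^ 3 \<le> \<delta> ^ 3 / 4 * ?N ^ 4"
    using mult_right_mono[OF N, of "?N ^ 3 / 4"] by (simp add: power3_eq_cube power4_eq_xxxx ac_simps)
  ultimately show ?thesis using X by argo
qed

section \<open>Packing exchanges\<close>

text \<open>\<open>q\<close> changes four pairs. Each can occur in \<open>q'\<close> in four places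
  and two orientations, with two vertices left free, which gives \<open>4 * 4 * 2\<close> times
  \<open>card V ^ 2\<close>.\<close>

lemma card_changed_Int_le:
  assumes "finite V"
  shows "card {q' \<in> (V \<times> V) \<times> (V \<times> V). changed q \<inter> changed q' \<noteq> {}} \<le> 32 * card V ^ 2"
proof -
  obtain a b c d where q: "q = ((a, c), (b, d))" by (metis surj_pair)
  \<comment> \<open>\<open>H (x, y)\<close> holds the exchanges in which \<open>(x, y)\<close> is,
    in this order of the union, \<open>(a, b)\<close>, \<open>(c, d)\<close>, \<open>(a, c)\<close>
    or \<open>(b, d)\<close>.\<close>
  define H where "H = (\<lambda>(x, y). (\<lambda>(u, v). ((x, u), (y, v))) ` (V \<times> V)
      \<union> (\<lambda>(u, v). ((u, x), (v, y))) ` (V \<times> V)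
      \<union> (\<lambda>(u, v). ((x, y), (u, v))) ` (V \<times> V) \<union> (\<lambda>(u, v). ((u, v), (x, y))) ` (V \<times> V) :: exchange set)"
  have H: "card (H p) \<le> 4 * card V ^ 2" for p
  proof -
    obtain x y where p: "p = (x, y)" by (metis surj_pair)
    have im: "card (f ` (V \<times> V)) \<le> card V ^ 2" for f :: "nat \<times> nat \<Rightarrow> exchange"
      using card_image_le[of "V \<times> V" f] assms by (simp add: card_cartesian_product power2_eq_square)
    have "card (H p) \<le> card V ^ 2 + card V ^ 2 + card V ^ 2 + card V ^ 2"
      unfolding H_def p prod.case
      by (intro order.trans[OF card_Un_le] add_mono im)
    then show ?thesis by simp
  qed
  have fin: "finite (H p)" for p
    unfolding H_def case_prod_beta using assms by blast
  have mem: "q' \<in> H (x, y) \<union> H (y, x)"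
    if "q' \<in> (V \<times> V) \<times> (V \<times> V)" "{x, y} \<in> changed q'" for q' x y
  proof -
    obtain a b c d where q': "q' = ((a, c), (b, d))" by (metis surj_pair)
    with that have "a \<in> V" "b \<in> V" "c \<in> V" "d \<in> V"
      and "(x, y) = (a, b) \<or> (x, y) = (b, a) \<or> (x, y) = (c, d) \<or> (x, y) = (d, c)
        \<or> (x, y) = (a, c) \<or> (x, y) = (c, a) \<or> (x, y) = (b, d) \<or> (x, y) = (d, b)"
      by (auto simp: changed_def doubleton_eq_iff)
    then show ?thesis
      unfolding H_def q' by (elim disjE) (force simp: image_iff)+
  qed
  let ?L = "[(a, b), (b, a), (c, d), (d, c), (a, c), (c, a), (b, d), (d, b)]"
  have "{q' \<in> (V \<times> V) \<times> (V \<times> V). changed q \<inter> changed q' \<noteq> {}} \<subseteq> (\<Union>p\<in>set ?L. H p)"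
  proof
    fix q' assume q': "q' \<in> {q' \<in> (V \<times> V) \<times> (V \<times> V). changed q \<inter> changed q' \<noteq> {}}"
    then have "{a, b} \<in> changed q' \<or> {c, d} \<in> changed q' \<or> {a, c} \<in> changed q' \<or> {b, d} \<in> changed q'"
      by (auto simp: q changed_def[of "((a, c), (b, d))"])
    with q' mem[of q' a b] mem[of q' c d] mem[of q' a c] mem[of q' b d]
    show "q' \<in> (\<Union>p\<in>set ?L. H p)" by auto
  qed
  then have "card {q' \<in> (V \<times> V) \<times> (V \<times> V). changed q \<inter> changed q' \<noteq> {}} \<le> card (\<Union>p\<in>set ?L. H p)"
    using fin by (intro card_mono) auto
  also have "\<dots> \<le> (\<Sum>p\<in>set ?L. card (H p))"
    by (intro card_UN_le) simp
  also have "\<dots> \<le> (\<Sum>p\<in>set ?L. 4 * card V ^ 2)"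
    by (intro sum_mono H)
  also have "\<dots> = card (set ?L) * (4 * card V ^ 2)"
    unfolding sum_constant by simp
  also have "\<dots> \<le> 8 * (4 * card V ^ 2)"
    using card_length[of ?L] by (intro mult_right_mono) auto
  finally show ?thesis by simp
qed

lemma card_exchanges_at_le:
  assumes "finite V"
  shows "card {q \<in> (V \<times> V) \<times> (V \<times> V). v \<in> verts q} \<le> 4 * card V ^ 3"
proof -
  let ?V3 = "V \<times> V \<times> V"
  have "{q \<in> (V \<times> V) \<times> (V \<times> V). v \<in> verts q}
      \<subseteq> (\<lambda>(x, y, z). ((v, x), (y, z))) ` ?V3 \<union> (\<lambda>(x, y, z). ((x, v), (y, z))) ` ?V3
        \<union> (\<lambda>(x, y, z). ((x, y), (v, z))) ` ?V3 \<union> (\<lambda>(x, y, z). ((x, y), (z, v))) ` ?V3"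
    (is "_ \<subseteq> ?U")
  proof
    fix q assume "q \<in> {q \<in> (V \<times> V) \<times> (V \<times> V). v \<in> verts q}"
    then obtain a b c d where q: "q = ((a, c), (b, d))" "a \<in> V" "b \<in> V" "c \<in> V" "d \<in> V"
      "v = a \<or> v = b \<or> v = c \<or> v = d"
      by auto
    then consider "q = (\<lambda>(x, y, z). ((v, x), (y, z))) (c, b, d)"
      | "q = (\<lambda>(x, y, z). ((x, v), (y, z))) (a, b, d)"
      | "q = (\<lambda>(x, y, z). ((x, y), (v, z))) (a, c, d)"
      | "q = (\<lambda>(x, y, z). ((x, y), (z, v))) (a, c, b)"
      by auto
    then show "q \<in> ?U"
      using q(2-5) by cases blast+
  qed
  then have "card {q \<in> (V \<times> V) \<times> (V \<times> V). v \<in> verts q} \<le> card ?U"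
    using assms by (intro card_mono) auto
  also have "\<dots> \<le> card V ^ 3 + card V ^ 3 + card V ^ 3 + card V ^ 3"
  proof -
    have "card (f ` ?V3) \<le> card V ^ 3" for f :: "nat \<times> nat \<times> nat \<Rightarrow> exchange"
      using card_image_le[of ?V3 f] assms by (simp add: card_cartesian_product power3_eq_cube)
    then show ?thesis
      by (intro order.trans[OF card_Un_le] add_mono)
  qed
  finally show ?thesis by simp
qed

lemma finite_verts [simp]: "finite (verts q)"
  by (cases q rule: verts.cases) auto

lemma sum_card_at_le:
  assumes "finite V" "finite Q"
  shows "(\<Sum>v\<in>V. card {q\<in>Q. v \<in> verts q}) \<le> 4 * card Q"
proof -
  have "(\<Sum>v\<in>V. card {q\<in>Q. v \<in> verts q}) = (\<Sum>v\<in>V. \<Sum>q\<in>Q. if v \<in> verts q then 1 else 0)"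
    using assms by (simp add: sum.If_cases Int_def)
  also have "\<dots> = (\<Sum>q\<in>Q. \<Sum>v\<in>V. if v \<in> verts q then 1 else 0)"
    by (rule sum.swap)
  also have "\<dots> = (\<Sum>q\<in>Q. card (V \<inter> verts q))"
    using assms by (simp add: sum.If_cases)
  also have "\<dots> \<le> (\<Sum>q\<in>Q. 4)"
  proof (intro sum_mono)
    fix q
    have "card (V \<inter> verts q) \<le> card (verts q)" by (intro card_mono) auto
    also have "\<dots> \<le> 4"
    proof (cases q rule: verts.cases)
      case (1 a c b d)
      then show ?thesis using card_length[of "[a, b, c, d]"] by simp
    qed
    finally show "card (V \<inter> verts q) \<le> 4" .
  qed
  finally show ?thesis by simp
qed

text \<open>Disjoint \<open>changed\<close> sets let any subfamily be performed at once and keep an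
  answer from revealing two groups. The cap on exchanges per vertex ensures that removals destroy at
  most half of the common neighbours guaranteed to each exchange.\<close>

locale exchange_packing =
  fixes n :: nat and E :: "nat set set" and V :: "nat set" and \<delta> :: real and Q :: "exchange set"
  assumes simple: "simple_graph n E"
    and V_subset: "V \<subseteq> {1..n}"
    and \<delta>_pos: "0 < \<delta>"
    and Q_good: "Q \<subseteq> good_exchanges E V \<delta>"
    and changed_disjoint: "q \<in> Q \<Longrightarrow> q' \<in> Q \<Longrightarrow> q \<noteq> q' \<Longrightarrow> changed q \<inter> changed q' = {}"
    and card_at_le: "real (card {q\<in>Q. v \<in> verts q}) \<le> \<delta> / 4 * real (card V)"
begin

lemma finite_V: "finite V"
  using V_subset finite_subset by blast

lemma finite_Q: "finite Q"
  by (rule finite_subset[of _ "(V \<times> V) \<times> (V \<times> V)"])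
    (use Q_good finite_V in \<open>auto simp: good_exchanges_def\<close>)

text \<open>Greedy step: a good exchange is unusable only if it shares a changed pair with
  \<open>Q\<close> (\<open>B1\<close>) or contains a vertex at its cap (\<open>B2\<close>). Both
  sets have size of order \<open>card Q * N^2\<close>, so for small \<open>Q\<close> they cannot
  cover the good exchanges.\<close>

lemma extend:
  assumes "\<delta> \<le> 1" and N: "8 \<le> \<delta> * real (card V)"
    and good: "\<delta> ^ 3 / 2 * real (card V) ^ 4 \<le> real (card (good_exchanges E V \<delta>))"
    and small: "real (card Q) < \<delta> ^ 4 / 320 * real (card V) ^ 2"
  shows "\<exists>q. q \<notin> Q \<and> exchange_packing n E V \<delta> (insert q Q)"
proof -
  let ?N = "real (card V)" and ?X = "(V \<times> V) \<times> (V \<times> V)"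
  define use where "use v = card {q\<in>Q. v \<in> verts q}" for v
  \<comment> \<open>Vertices at which one more exchange would exceed the cap.\<close>
  define Sat where "Sat = {v\<in>V. \<delta> / 4 * ?N < real (use v) + 1}"
  define B1 where "B1 = (\<Union>q\<in>Q. {q' \<in> ?X. changed q \<inter> changed q' \<noteq> {}})"
  define B2 where "B2 = (\<Union>v\<in>Sat. {q \<in> ?X. v \<in> verts q})"
  have Npos: "0 < ?N" using N \<delta>_pos by (auto simp: zero_less_mult_iff intro: ccontr)
  have finSat: "finite Sat" using finite_V by (simp add: Sat_def)
  have "card B1 \<le> (\<Sum>q\<in>Q. card {q' \<in> ?X. changed q \<inter> changed q' \<noteq> {}})"
    unfolding B1_def by (rule card_UN_le[OF finite_Q])
  also have "\<dots> \<le> (\<Sum>q\<in>Q. 32 * card V ^ 2)"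
    by (intro sum_mono card_changed_Int_le finite_V)
  finally have "card B1 \<le> card Q * (32 * card V ^ 2)" by simp
  from of_nat_mono[where 'a = real, OF this] have B1: "real (card B1) \<le> 32 * ?N ^ 2 * real (card Q)"
    by (simp add: ac_simps)
  have "card B2 \<le> (\<Sum>v\<in>Sat. card {q \<in> ?X. v \<in> verts q})"
    unfolding B2_def by (rule card_UN_le[OF finSat])
  also have "\<dots> \<le> (\<Sum>v\<in>Sat. 4 * card V ^ 3)"
    by (intro sum_mono card_exchanges_at_le finite_V)
  finally have "card B2 \<le> card Sat * (4 * card V ^ 3)" by simp
  from of_nat_mono[where 'a = real, OF this] have B2: "real (card B2) \<le> 4 * ?N ^ 3 * real (card Sat)"
    by (simp add: ac_simps)
  \<comment> \<open>A saturated vertex has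
    \<open>use v > \<delta> * N / 4 - 1 \<ge> \<delta> * N / 8\<close>, since
    \<open>\<delta> * N \<ge> 8\<close>. Each exchange has at most four vertices.\<close>
  have "real (card Sat) * (\<delta> * ?N / 8) = (\<Sum>v\<in>Sat. \<delta> * ?N / 8)" by simp
  also have "\<dots> \<le> (\<Sum>v\<in>Sat. real (use v))"
    using N by (intro sum_mono) (auto simp: Sat_def)
  also have "\<dots> \<le> (\<Sum>v\<in>V. real (use v))"
    using finite_V by (intro sum_mono2) (auto simp: Sat_def)
  also have "\<dots> \<le> 4 * real (card Q)"
    using of_nat_mono[where 'a = real, OF sum_card_at_le[OF finite_V finite_Q]]
    unfolding use_def by simp
  finally have Sat: "\<delta> * ?N * real (card Sat) \<le> 32 * real (card Q)" by (simp add: ac_simps)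
  have "\<delta> * real (card B2) \<le> 4 * ?N ^ 2 * (\<delta> * ?N * real (card Sat))"
    using mult_left_mono[OF B2, of \<delta>] \<delta>_pos by (simp add: power2_eq_square power3_eq_cube ac_simps)
  also have "\<dots> \<le> 4 * ?N ^ 2 * (32 * real (card Q))"
    using Sat by (intro mult_left_mono) auto
  finally have B2': "\<delta> * real (card B2) \<le> 128 * ?N ^ 2 * real (card Q)" by simp
  have "\<delta> * real (card B1) \<le> real (card B1)"
    using \<open>\<delta> \<le> 1\<close> by (simp add: mult_left_le_one_le \<delta>_pos less_imp_le)
  with B1 B2' have "\<delta> * (real (card B1) + real (card B2)) \<le> 160 * ?N ^ 2 * real (card Q)"
    by (simp add: distrib_left)
  \<comment> \<open>The denominator 320 is chosen so that \<open>160 / 320\<close> matches the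
    factor 1/2 in the number of good exchanges.\<close>
  also have "\<dots> < 160 * ?N ^ 2 * (\<delta> ^ 4 / 320 * ?N ^ 2)"
    using small Npos by (intro mult_strict_left_mono) auto
  also have "\<dots> = \<delta> * (\<delta> ^ 3 / 2 * ?N ^ 4)"
    by (simp add: power2_eq_square power3_eq_cube power4_eq_xxxx)
  finally have "real (card B1) + real (card B2) < \<delta> ^ 3 / 2 * ?N ^ 4"
    using \<delta>_pos by simp
  with good have "real (card B1 + card B2) < real (card (good_exchanges E V \<delta>))" by simp
  then have "card (B1 \<union> B2) < card (good_exchanges E V \<delta>)"
    using card_Un_le[of B1 B2] by linarith
  moreover have "finite (B1 \<union> B2)"
    by (rule finite_subset[of _ ?X]) (use finite_V in \<open>auto simp: B1_def B2_def\<close>)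
  ultimately have "\<not> good_exchanges E V \<delta> \<subseteq> B1 \<union> B2"
    using card_mono by (meson leD)
  then obtain q where q: "q \<in> good_exchanges E V \<delta>" "q \<notin> B1" "q \<notin> B2" by blast
  then have qX: "q \<in> ?X" by (simp add: good_exchanges_def)
  then have disj: "changed q' \<inter> changed q = {}" if "q' \<in> Q" for q'
    using that q(2) by (auto simp: B1_def)
  have "changed q \<noteq> {}" by (cases q rule: verts.cases) (auto simp: changed_def)
  then have "q \<notin> Q" using disj by blast
  moreover have "exchange_packing n E V \<delta> (insert q Q)"
  proof
    fix q1 q2 assume "q1 \<in> insert q Q" "q2 \<in> insert q Q" "q1 \<noteq> q2"
    then show "changed q1 \<inter> changed q2 = {}"
      using disj changed_disjoint by (metis Int_commute insertE)
  next
    fix v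
    show "real (card {q'\<in>insert q Q. v \<in> verts q'}) \<le> \<delta> / 4 * ?N"
    proof (cases "v \<in> verts q")
      case True
      have "verts q \<subseteq> V" using qX by (cases q rule: verts.cases) auto
      with True q(3) qX have "\<not> \<delta> / 4 * ?N < real (use v) + 1"
        by (auto simp: B2_def Sat_def)
      moreover have "{q'\<in>insert q Q. v \<in> verts q'} = insert q {q'\<in>Q. v \<in> verts q'}"
        using True by auto
      ultimately show ?thesis
        using \<open>q \<notin> Q\<close> finite_Q by (simp add: use_def)
    next
      case False
      then have "{q'\<in>insert q Q. v \<in> verts q'} = {q'\<in>Q. v \<in> verts q'}" by auto
      then show ?thesis using card_at_le by simp
    qed
  qed (use simple V_subset \<delta>_pos Q_good q(1) in auto)
  ultimately show ?thesis by blast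
qed

end

lemma exchange_packing_exists:
  fixes \<delta> :: real
  assumes E: "simple_graph n E" and V: "V \<subseteq> {1..n}" and "0 < \<delta>" "\<delta> \<le> 1"
    and N: "8 \<le> \<delta> ^ 3 * real (card V)"
    and P: "\<delta> * real (card V) ^ 2
      \<le> real (card {(a, c) \<in> V \<times> V. \<delta> * real (card V) \<le> real (card (common_nbrs E V a c))})"
    and O: "real (card (ordered_triangles E V)) \<le> \<delta> ^ 3 / 8 * real (card V) ^ 3"
  shows "\<exists>Q. exchange_packing n E V \<delta> Q \<and> \<delta> ^ 4 / 320 * real (card V) ^ 2 \<le> real (card Q)"
proof -
  let ?\<mu> = "\<delta> ^ 4 / 320 * real (card V) ^ 2"
  have "finite V" using V finite_subset by blast
  note good = card_good_exchanges_ge[OF this E \<open>0 < \<delta>\<close> N P O]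
  have "\<delta> ^ 3 \<le> \<delta>"
    using power_decreasing[of 1 3 \<delta>] \<open>0 < \<delta>\<close> \<open>\<delta> \<le> 1\<close> by simp
  then have "\<delta> ^ 3 * real (card V) \<le> \<delta> * real (card V)"
    by (intro mult_right_mono) auto
  with N have N': "8 \<le> \<delta> * real (card V)" by linarith
  \<comment> \<open>Packings of size below \<open>?\<mu>\<close> can be extended, so every size up
    to the ceiling of \<open>?\<mu>\<close> is reached.\<close>
  have "\<exists>Q. exchange_packing n E V \<delta> Q \<and> card Q = k" if "real k < ?\<mu> + 1" for k
    using that
  proof (induction k)
    case 0
    have "exchange_packing n E V \<delta> {}"
      using E V \<open>0 < \<delta>\<close> by unfold_locales auto
    then show ?case by force
  next
    case (Suc k)
    then obtain Q where Q: "exchange_packing n E V \<delta> Q" "card Q = k" by force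
    from Suc.prems Q(2) have "real (card Q) < ?\<mu>" by simp
    from exchange_packing.extend[OF Q(1) \<open>\<delta> \<le> 1\<close> N' good this]
    obtain q where "q \<notin> Q" "exchange_packing n E V \<delta> (insert q Q)" by blast
    with Q show ?case
      using exchange_packing.finite_Q[OF Q(1)] by (intro exI[of _ "insert q Q"]) simp
  qed
  moreover have "0 \<le> ?\<mu>" by simp
  then have "real (nat \<lceil>?\<mu>\<rceil>) < ?\<mu> + 1" by linarith
  ultimately obtain Q where "exchange_packing n E V \<delta> Q" "card Q = nat \<lceil>?\<mu>\<rceil>" by blast
  then show ?thesis by (metis real_nat_ceiling_ge)
qed

section \<open>Performing exchanges\<close>

lemma neighbours_UN: "neighbours (\<Union>q\<in>G. f q) v = (\<Union>q\<in>G. neighbours (f q) v)"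
  by (auto simp: neighbours_def)

lemma deg_UN_disjoint:
  assumes "finite G" "\<And>q. q \<in> G \<Longrightarrow> finite (neighbours (f q) v)"
    and "\<And>q q'. q \<in> G \<Longrightarrow> q' \<in> G \<Longrightarrow> q \<noteq> q' \<Longrightarrow> f q \<inter> f q' = {}"
  shows "deg (\<Union>q\<in>G. f q) v = (\<Sum>q\<in>G. deg (f q) v)"
  unfolding deg_def neighbours_UN
  using assms by (intro card_UN_disjoint) (auto simp: neighbours_def)

lemma neighbours_two_edges:
  assumes "distinct [a, b, c, d]"
  shows "neighbours {{a, b}, {c, d}} v
    = (if v = a then {b} else if v = b then {a} else if v = c then {d} else if v = d then {c} else {})"
  using assms by (auto simp: neighbours_def doubleton_eq_iff)

text \<open>\<open>removed q\<close> and \<open>added q\<close> are both perfect matchings of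
  \<open>verts q\<close>, which is why an exchange preserves degrees.\<close>

lemma exchangeable_neighbours:
  assumes "exchangeable E q"
  shows "finite (neighbours (removed q) v)" "finite (neighbours (added q) v)"
    and "deg (removed q) v = of_bool (v \<in> verts q)" "deg (added q) v = of_bool (v \<in> verts q)"
proof -
  obtain a b c d where q: "q = ((a, c), (b, d))" by (metis surj_pair)
  then have "distinct [a, b, c, d]" "distinct [a, c, b, d]"
    using assms card_verts_eq_4_iff[of a c b d] by (auto simp: exchangeable_def)
  note nb = this[THEN neighbours_two_edges, of v]
  show "finite (neighbours (removed q) v)" "finite (neighbours (added q) v)"
    "deg (removed q) v = of_bool (v \<in> verts q)" "deg (added q) v = of_bool (v \<in> verts q)"
    unfolding deg_def q removed.simps added.simps nb by auto
qed

lemma exchangeable_card: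
  assumes "exchangeable E q"
  shows "card (removed q) = 2" "card (added q) = 2"
proof -
  obtain a b c d where q: "q = ((a, c), (b, d))" by (metis surj_pair)
  then have "distinct [a, b, c, d]"
    using assms card_verts_eq_4_iff[of a c b d] by (auto simp: exchangeable_def)
  then show "card (removed q) = 2" "card (added q) = 2"
    by (auto simp: q card_insert_if doubleton_eq_iff)
qed

context exchange_packing
begin

definition exchange :: "exchange set \<Rightarrow> nat set set" where
  "exchange G = (E - (\<Union>q\<in>G. removed q)) \<union> (\<Union>q\<in>G. added q)"

context
  fixes G :: "exchange set"
  assumes G: "G \<subseteq> Q"
begin

lemma finite_G: "finite G"
  using G finite_Q finite_subset by blast

lemma G_exchangeable: "q \<in> G \<Longrightarrow> exchangeable E q"
  using G Q_good by (auto simp: good_exchanges_def)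

lemma G_disjoint:
  assumes "q \<in> G" "q' \<in> G" "q \<noteq> q'"
  shows "removed q \<inter> removed q' = {}" "added q \<inter> added q' = {}"
  using changed_disjoint[of q q'] assms G by (auto simp: changed_def)

lemma removed_subset: "(\<Union>q\<in>G. removed q) \<subseteq> E"
  using G_exchangeable by (auto simp: exchangeable_def)

lemma added_Int_edges: "(\<Union>q\<in>G. added q) \<inter> E = {}"
  using G_exchangeable by (auto simp: exchangeable_def)

lemma exchange_diff: "(E - exchange G) \<union> (exchange G - E) \<subseteq> (\<Union>q\<in>G. changed q)"
  by (auto simp: exchange_def changed_def)

lemma simple_graph_exchange: "simple_graph n (exchange G)"
proof -
  have "e \<subseteq> {1..n} \<and> card e = 2" if "q \<in> G" "e \<in> added q" for q e
  proof -
    obtain a b c d where q: "q = ((a, c), (b, d))" by (metis surj_pair)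
    have "a \<in> V" "b \<in> V" "c \<in> V" "d \<in> V"
      using that(1) G Q_good q by (auto simp: good_exchanges_def)
    moreover have "distinct [a, b, c, d]"
      using G_exchangeable[OF that(1)] card_verts_eq_4_iff[of a c b d] q by (auto simp: exchangeable_def)
    ultimately show ?thesis
      using that(2) V_subset q by auto
  qed
  then show ?thesis
    using simple unfolding simple_graph_def exchange_def by blast
qed

lemma card_exchange: "card (exchange G) = card E"
proof -
  have fin: "finite E" using simple_graph_finite[OF simple] .
  have "card (\<Union>q\<in>G. removed q) = (\<Sum>q\<in>G. card (removed q))"
    using finite_G G_disjoint exchangeable_card[OF G_exchangeable]
    by (intro card_UN_disjoint) (auto intro: card_ge_0_finite)
  also have "\<dots> = (\<Sum>q\<in>G. card (added q))"
    using exchangeable_card[OF G_exchangeable] by (intro sum.cong) auto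
  also have "\<dots> = card (\<Union>q\<in>G. added q)"
    using finite_G G_disjoint exchangeable_card[OF G_exchangeable]
    by (intro card_UN_disjoint[symmetric]) (auto intro: card_ge_0_finite)
  finally have eq: "card (\<Union>q\<in>G. removed q) = card (\<Union>q\<in>G. added q)" .
  have "finite (\<Union>q\<in>G. added q)"
    using simple_graph_finite[OF simple_graph_exchange] by (auto simp: exchange_def)
  then have "card (exchange G) = card (E - (\<Union>q\<in>G. removed q)) + card (\<Union>q\<in>G. added q)"
    unfolding exchange_def using fin added_Int_edges by (intro card_Un_disjoint) auto
  also have "\<dots> = card E - card (\<Union>q\<in>G. removed q) + card (\<Union>q\<in>G. added q)"
    using removed_subset fin finite_subset by (subst card_Diff_subset) auto
  also have "\<dots> = card E"
    using card_mono[OF fin removed_subset] eq by linarith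
  finally show ?thesis .
qed

lemma deg_removed: "deg (\<Union>q\<in>G. removed q) v = card {q\<in>G. v \<in> verts q}"
  and deg_added: "deg (\<Union>q\<in>G. added q) v = card {q\<in>G. v \<in> verts q}"
proof -
  have "(\<Sum>q\<in>G. of_bool (v \<in> verts q)) = card {q\<in>G. v \<in> verts q}"
    using finite_G by (simp add: of_bool_def sum.If_cases Int_def)
  moreover have "deg (\<Union>q\<in>G. removed q) v = (\<Sum>q\<in>G. of_bool (v \<in> verts q))"
    using finite_G G_disjoint exchangeable_neighbours[OF G_exchangeable]
    by (subst deg_UN_disjoint) auto
  moreover have "deg (\<Union>q\<in>G. added q) v = (\<Sum>q\<in>G. of_bool (v \<in> verts q))"
    using finite_G G_disjoint exchangeable_neighbours[OF G_exchangeable]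
    by (subst deg_UN_disjoint) auto
  ultimately show "deg (\<Union>q\<in>G. removed q) v = card {q\<in>G. v \<in> verts q}"
    "deg (\<Union>q\<in>G. added q) v = card {q\<in>G. v \<in> verts q}" by simp_all
qed

lemma finite_neighbours_removed: "finite (neighbours (\<Union>q\<in>G. removed q) v)"
  by (rule finite_subset[OF _ finite_neighbours[OF simple, of v]])
    (use removed_subset in \<open>auto simp: neighbours_def\<close>)

lemma deg_exchange: "deg (exchange G) v = deg E v"
proof -
  let ?R = "neighbours (\<Union>q\<in>G. removed q) v" and ?A = "neighbours (\<Union>q\<in>G. added q) v"
  have sub: "?R \<subseteq> neighbours E v" using removed_subset by (auto simp: neighbours_def)
  have fin: "finite (neighbours E v)" using finite_neighbours[OF simple] .
  have "finite ?A"
    by (rule finite_subset[OF _ finite_neighbours[OF simple_graph_exchange, of v]])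
      (auto simp: neighbours_def exchange_def)
  moreover have "neighbours (exchange G) v = (neighbours E v - ?R) \<union> ?A"
    by (auto simp: neighbours_def exchange_def)
  moreover have "(neighbours E v - ?R) \<inter> ?A = {}"
    using added_Int_edges by (auto simp: neighbours_def)
  ultimately have "deg (exchange G) v = card (neighbours E v - ?R) + card ?A"
    unfolding deg_def using fin by (simp add: card_Un_disjoint)
  also have "\<dots> = card (neighbours E v) - card ?R + card ?A"
    using sub finite_neighbours_removed by (subst card_Diff_subset) auto
  also have "\<dots> = card (neighbours E v)"
    using card_mono[OF fin sub] deg_removed[of v] deg_added[of v] by (simp add: deg_def)
  finally show ?thesis by (simp add: deg_def)
qed

text \<open>Only triangles with exactly one added edge are counted. Their other two edges are in
  \<open>E\<close>, so the added edge is determined by the triangle.\<close>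

lemma triangle_count_exchange_ge:
  "real (card G) * (\<delta> / 2 * real (card V)) \<le> real (triangle_count (exchange G))"
proof -
  let ?N = "real (card V)" and ?R = "\<Union>q\<in>G. removed q"
  \<comment> \<open>Common neighbours of \<open>a\<close> and \<open>c\<close> whose edges to both
    survive all removals in \<open>G\<close>.\<close>
  define W where "W q = {w \<in> common_nbrs E V (fst (fst q)) (snd (fst q)).
    {fst (fst q), w} \<notin> ?R \<and> {snd (fst q), w} \<notin> ?R}" for q :: exchange
  have finW: "finite (W q)" for q
    by (rule finite_subset[OF _ finite_V]) (auto simp: W_def common_nbrs_def)
  have W: "\<delta> / 2 * ?N \<le> real (card (W q))" if q: "q \<in> G" for q
  proof -
    let ?a = "fst (fst q)" and ?c = "snd (fst q)"
    have R: "real (card (neighbours ?R v)) \<le> \<delta> / 4 * ?N" for v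
    proof -
      have "card {q\<in>G. v \<in> verts q} \<le> card {q\<in>Q. v \<in> verts q}"
        using G finite_Q by (intro card_mono) auto
      then show ?thesis
        using card_at_le[of v] deg_removed[of v] by (simp add: deg_def)
    qed
    \<comment> \<open>Removals cost at most \<open>\<delta> / 4 * N\<close> neighbours at each of
      \<open>a\<close> and \<open>c\<close>, leaving half of \<open>\<delta> * N\<close>.\<close>
    have "common_nbrs E V ?a ?c \<subseteq> W q \<union> (neighbours ?R ?a \<union> neighbours ?R ?c)"
      by (auto simp: W_def neighbours_def insert_commute)
    then have "card (common_nbrs E V ?a ?c) \<le> card (W q \<union> (neighbours ?R ?a \<union> neighbours ?R ?c))"
      using finW finite_neighbours_removed by (intro card_mono) auto
    also have "\<dots> \<le> card (W q) + (card (neighbours ?R ?a) + card (neighbours ?R ?c))"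
      by (intro order.trans[OF card_Un_le] add_mono order.refl)
    finally have "real (card (common_nbrs E V ?a ?c))
        \<le> real (card (W q)) + real (card (neighbours ?R ?a)) + real (card (neighbours ?R ?c))"
      by linarith
    moreover have "\<delta> * ?N \<le> real (card (common_nbrs E V ?a ?c))"
      using q G Q_good by (auto simp: good_exchanges_def)
    ultimately show ?thesis using R[of ?a] R[of ?c] by argo
  qed
  have ac: "{fst (fst q), snd (fst q)} \<notin> E" "{fst (fst q), snd (fst q)} \<in> added q"
    "fst (fst q) \<noteq> snd (fst q)" if "q \<in> G" for q
  proof -
    obtain a b c d where q: "q = ((a, c), (b, d))" by (metis surj_pair)
    then show "{fst (fst q), snd (fst q)} \<notin> E" "{fst (fst q), snd (fst q)} \<in> added q"
      "fst (fst q) \<noteq> snd (fst q)"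
      using G_exchangeable[OF that] card_verts_eq_4_iff[of a c b d] by (auto simp: exchangeable_def)
  qed
  define T where "T = (\<lambda>(q :: exchange, w). {fst (fst q), snd (fst q), w})"
  have "inj_on T (SIGMA q:G. W q)"
  proof (rule inj_onI, clarify)
    fix p w p' w'
    assume p: "p \<in> G" "w \<in> W p" and p': "p' \<in> G" "w' \<in> W p'" and eq: "T (p, w) = T (p', w')"
    obtain a c r a' c' r' where pp: "p = ((a, c), r)" "p' = ((a', c'), r')" by (metis surj_pair)
    have w: "{a, w} \<in> E" "{c, w} \<in> E" "{a', w'} \<in> E" "{c', w'} \<in> E"
      using p(2) p'(2) by (auto simp: W_def common_nbrs_def pp)
    have ne: "w \<noteq> a" "w \<noteq> c" "w' \<noteq> a'" "w' \<noteq> c'"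
      using w simple_graphD(3)[OF simple] by blast+
    have acw: "{a, c, w} = {a', c', w'}" using eq by (simp add: T_def pp)
    then have mem: "a \<in> {a', c', w'}" "c \<in> {a', c', w'}" by blast+
    have "{a, c} \<notin> E" "{c, a} \<notin> E" "a \<noteq> c"
      using ac[OF p(1)] by (auto simp: pp insert_commute)
    \<comment> \<open>In its triangle \<open>w'\<close> is joined by \<open>E\<close> to both other
      vertices, whereas \<open>a\<close> and \<open>c\<close> are not joined to each other.\<close>
    moreover from this have "a \<noteq> w'" "c \<noteq> w'" using mem w by blast+
    ultimately have "{a, c} = {a', c'}" using mem by blast
    moreover from this have "w = w'" using acw ne by blast
    moreover have "p = p'"
    proof (rule ccontr)
      assume "p \<noteq> p'"
      with G_disjoint(2)[OF p(1) p'(1)] ac(2)[OF p(1)] ac(2)[OF p'(1)] \<open>{a, c} = {a', c'}\<close>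
      show False by (auto simp: pp)
    qed
    ultimately show "p = p' \<and> w = w'" by simp
  qed
  moreover have "T ` (SIGMA q:G. W q) \<subseteq> triangles (exchange G)"
  proof (rule image_subsetI, clarify)
    fix p w assume p: "p \<in> G" "w \<in> W p"
    obtain a c r where pp: "p = ((a, c), r)" by (metis surj_pair)
    have w: "{a, w} \<in> E" "{c, w} \<in> E" "{a, w} \<notin> ?R" "{c, w} \<notin> ?R"
      using p(2) by (auto simp: W_def common_nbrs_def pp)
    then have ne: "w \<noteq> a" "w \<noteq> c"
      using simple_graphD(3)[OF simple] by blast+
    have "{a, c} \<in> exchange G" "{a, w} \<in> exchange G" "{c, w} \<in> exchange G" "a \<noteq> c"
      using ac[OF p(1)] p(1) w by (auto simp: exchange_def pp)
    then have "{a, c, w} \<in> triangles (exchange G)"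
      using ne by (auto simp: triangles_def insert_commute)
    then show "T (p, w) \<in> triangles (exchange G)" by (simp add: T_def pp)
  qed
  ultimately have le: "card (SIGMA q:G. W q) \<le> triangle_count (exchange G)"
    unfolding triangle_count_def
    using finite_triangles[OF simple_graph_exchange] by (rule card_inj_on_le)
  have "real (card G) * (\<delta> / 2 * ?N) \<le> (\<Sum>q\<in>G. real (card (W q)))"
    using W by (rule sum_bounded_below)
  also have "\<dots> = real (card (SIGMA q:G. W q))"
    using finite_G finW by simp
  also have "\<dots> \<le> real (triangle_count (exchange G))"
    using le by (rule of_nat_mono)
  finally show ?thesis .
qed

end

end

section \<open>The lower bound from a packing\<close>

lemma triangle_count_empty [simp]: "triangle_count {} = 0"
proof -
  have "T \<notin> triangles {}" for T
    by (auto simp: triangles_def card_3_iff)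
  then have "triangles {} = {}" by blast
  then show ?thesis by (simp add: triangle_count_def)
qed

text \<open>On the edgeless graph only the output 0 is acceptable, and 0 does not approximate a
  positive count since \<open>\<epsilon> < 1\<close>. Declaring every answer touching makes this the
  case of a single modification: some query must be asked with probability at least 1/6.\<close>

lemma expected_queries_ge_one_sixth:
  assumes A: "computes_approximation n \<epsilon> (\<lambda>E. real (triangle_count E)) A" and "\<epsilon> < 1"
    and valid: "valid_input n E nbr" and t: "1 \<le> triangle_count E"
  shows "ennreal (1 / 6) \<le> expected_queries A E nbr"
proof -
  have "simple_graph n {}" by (simp add: simple_graph_def)
  then obtain nbr' where nbr': "valid_input n {} nbr'" using valid_input_exists by blast
  have all_hidden: "map_pmf (hide (\<lambda>_. True)) p = return_pmf None" for p :: "answer pmf"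
  proof -
    have "hide (\<lambda>_. True) = (\<lambda>_ :: answer. None)" by (simp add: fun_eq_iff hide_def)
    then show ?thesis by simp
  qed
  have "\<epsilon> * real (triangle_count E) < real (triangle_count E)"
    using \<open>\<epsilon> < 1\<close> t by simp
  then have "ennreal (real (card {()}) / 6) \<le> expected_queries A E nbr"
    by (intro expected_queries_ge[where F = "\<lambda>_. {}" and nbr' = "\<lambda>_. nbr'"
          and \<tau> = "\<lambda>_ _ _. True", OF A valid])
      (auto simp: nbr' all_hidden)
  then show ?thesis by simp
qed

context exchange_packing
begin

text \<open>Each group of \<open>K\<close> exchanges alone raises the count beyond the factor
  \<open>(1 + \<epsilon>) / (1 - \<epsilon>)\<close>, which makes the two ranges of acceptable
  outputs disjoint. Groups have disjoint changed pairs, so an answer reveals at most one of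
  them.\<close>

lemma expected_queries_ge_groups:
  assumes A: "computes_approximation n \<epsilon> (\<lambda>E. real (triangle_count E)) A"
    and "0 < \<epsilon>" "\<epsilon> < 1"
    and valid: "valid_input n E nbr"
    and K: "(1 + \<epsilon>) / (1 - \<epsilon>) * real (triangle_count E) < real K * (\<delta> / 2 * real (card V))"
  shows "ennreal (real (card Q div K) / 6) \<le> expected_queries A E nbr"
proof -
  let ?J = "{..<card Q div K}"
  obtain f where f: "bij_betw f {0..<card Q} Q"
    using ex_bij_betw_nat_finite[OF finite_Q] by blast
  \<comment> \<open>Consecutive blocks of an enumeration of \<open>Q\<close>; the last
    \<open>card Q mod K\<close> exchanges belong to no group.\<close>
  define G where "G j = f ` {j * K..<Suc j * K}" for j
  define D where "D j = (\<Union>q\<in>G j. changed q)" for j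
  have range: "{j * K..<Suc j * K} \<subseteq> {0..<card Q}" if "j \<in> ?J" for j
  proof -
    have "Suc j * K \<le> card Q div K * K" using that by (intro mult_right_mono) auto
    also have "\<dots> \<le> card Q" by (rule div_times_less_eq_dividend)
    finally show ?thesis by auto
  qed
  have G: "G j \<subseteq> Q" if "j \<in> ?J" for j
    using range[OF that] bij_betw_imp_surj_on[OF f] by (auto simp: G_def)
  have card_G: "card (G j) = K" if "j \<in> ?J" for j
    using card_image[OF inj_on_subset[OF bij_betw_imp_inj_on[OF f] range[OF that]]]
    by (simp add: G_def)
  have disj: "D i \<inter> D j = {}" if "i \<in> ?J" "j \<in> ?J" "i < j" for i j
  proof -
    have "Suc i * K \<le> j * K" using that by (intro mult_right_mono) auto
    then have "{i * K..<Suc i * K} \<inter> {j * K..<Suc j * K} = {}" by auto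
    then have "G i \<inter> G j = {}"
      unfolding G_def
      using inj_on_image_Int[OF bij_betw_imp_inj_on[OF f] range[OF that(1)] range[OF that(2)]]
      by (metis image_empty)
    then have "changed q \<inter> changed q' = {}" if "q \<in> G i" "q' \<in> G j" for q q'
      using changed_disjoint[of q q'] that G[OF \<open>i \<in> ?J\<close>] G[OF \<open>j \<in> ?J\<close>] by blast
    then show ?thesis unfolding D_def by blast
  qed
  have "\<exists>nbr'. valid_input n (exchange (G j)) nbr' \<and>
      (\<forall>q. map_pmf (hide (reveals (D j) q)) (answer_pmf E nbr q)
        = map_pmf (hide (reveals (D j) q)) (answer_pmf (exchange (G j)) nbr' q))"
    if "j \<in> ?J" for j
    using same_degrees_indistinguishable[OF valid simple_graph_exchange[OF G[OF that]]
        deg_exchange[OF G[OF that]] card_exchange[OF G[OF that]] exchange_diff[OF G[OF that]]]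
    unfolding D_def by metis
  then obtain nbr' where nbr': "\<And>j. j \<in> ?J \<Longrightarrow> valid_input n (exchange (G j)) (nbr' j)"
    "\<And>j q. j \<in> ?J \<Longrightarrow> map_pmf (hide (reveals (D j) q)) (answer_pmf E nbr q)
        = map_pmf (hide (reveals (D j) q)) (answer_pmf (exchange (G j)) (nbr' j) q)"
    by metis
  have "ennreal (real (card ?J) / 6) \<le> expected_queries A E nbr"
  proof (rule expected_queries_ge[OF A valid _ nbr'(1) _ nbr'(2)])
    fix j x
    assume j: "j \<in> ?J" and x: "\<bar>x - real (triangle_count E)\<bar> \<le> \<epsilon> * real (triangle_count E)"
    show "\<not> \<bar>x - real (triangle_count (exchange (G j)))\<bar> \<le> \<epsilon> * real (triangle_count (exchange (G j)))"
    proof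
      let ?t' = "real (triangle_count (exchange (G j)))"
      assume "\<bar>x - ?t'\<bar> \<le> \<epsilon> * ?t'"
      then have "(1 - \<epsilon>) * ?t' \<le> (1 + \<epsilon>) * real (triangle_count E)"
        using x by (simp add: algebra_simps abs_le_iff)
      moreover have "(1 + \<epsilon>) / (1 - \<epsilon>) * real (triangle_count E) < ?t'"
        using triangle_count_exchange_ge[OF G[OF j]] unfolding card_G[OF j]
        by (rule order.strict_trans2[OF K])
      then have "(1 + \<epsilon>) * real (triangle_count E) < (1 - \<epsilon>) * ?t'"
        using \<open>\<epsilon> < 1\<close> by (simp add: field_simps)
      ultimately show False by simp
    qed
  next
    fix q a i j assume "i \<in> ?J" "j \<in> ?J" "reveals (D i) q a" "reveals (D j) q a"
    then show "i = j"
      using disj[of i j] disj[of j i] reveals_disjoint[of "D i" q a "D j"]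
        reveals_disjoint[of "D j" q a "D i"] by (meson linorder_neqE_nat)
  qed auto
  then show ?thesis by simp
qed

text \<open>\<open>K\<close> is about \<open>1 + C * t / N\<close>, enough for \<open>K\<close>
  exchanges to outweigh the \<open>t\<close> old triangles, so \<open>card Q / K\<close> is at least
  of the order of \<open>\<mu>\<close> times the minimum. If \<open>Q\<close> is too small for one
  group, the claimed bound is at most 1/6 and comparison with the edgeless graph gives it.\<close>

lemma expected_queries_ge_min:
  assumes A: "computes_approximation n \<epsilon> (\<lambda>E. real (triangle_count E)) A"
    and \<epsilon>: "0 < \<epsilon>" "\<epsilon> < 1"
    and valid: "valid_input n E nbr" and t: "1 \<le> triangle_count E" and V: "V \<noteq> {}"
    and Q: "\<mu> * real (card V) ^ 2 \<le> real (card Q)" and "0 \<le> \<mu>"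
  shows "ennreal (\<mu> / (12 * (2 * ((1 + \<epsilon>) / (1 - \<epsilon>)) / \<delta> + 1))
      * min (real (card V) ^ 2) (real (card V) ^ 3 / real (triangle_count E)))
    \<le> expected_queries A E nbr"
proof -
  let ?N = "real (card V)" and ?t = "real (triangle_count E)"
  define C where "C = 2 * ((1 + \<epsilon>) / (1 - \<epsilon>)) / \<delta>"
  \<comment> \<open>Floor plus one rather than a ceiling, because the count must be exceeded
    strictly.\<close>
  define K where "K = nat \<lfloor>C * ?t / ?N\<rfloor> + 1"
  have N: "0 < ?N" using V finite_V by (simp add: card_gt_0_iff)
  have C: "0 \<le> C" using \<epsilon> \<delta>_pos by (simp add: C_def)
  then have nonneg: "0 \<le> C * ?t / ?N" by simp
  then have K: "C * ?t / ?N < real K" "real K \<le> C * ?t / ?N + 1"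
    unfolding K_def by linarith+
  have "C * ?t < real K * ?N" using K(1) N by (simp add: field_simps)
  then have "C * ?t * (\<delta> / 2) < real K * ?N * (\<delta> / 2)"
    using \<delta>_pos by (intro mult_strict_right_mono) auto
  moreover have "C * (\<delta> / 2) = (1 + \<epsilon>) / (1 - \<epsilon>)"
  proof -
    have "2 * x / \<delta> * (\<delta> / 2) = x" for x :: real using \<delta>_pos by simp
    then show ?thesis unfolding C_def .
  qed
  then have "(1 + \<epsilon>) / (1 - \<epsilon>) * ?t = C * ?t * (\<delta> / 2)" by (metis mult.assoc mult.commute)
  ultimately have "(1 + \<epsilon>) / (1 - \<epsilon>) * ?t < real K * (\<delta> / 2 * ?N)" by (simp only: ac_simps)
  note groups = expected_queries_ge_groups[OF A \<epsilon> valid this]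
  \<comment> \<open>The minimum is \<open>N^2\<close> for \<open>t \<le> N\<close>, where
    \<open>K \<le> C + 1\<close>, and \<open>N^3 / t\<close> for \<open>t > N\<close>, where
    \<open>K \<le> (C + 1) * t / N\<close>.\<close>
  have K_le: "real K * min (?N ^ 2) (?N ^ 3 / ?t) \<le> (C + 1) * ?N ^ 2"
  proof (cases "?t \<le> ?N")
    case True
    then have "C * ?t / ?N \<le> C"
      using C N by (simp add: field_simps mult_left_mono)
    then have "real K * min (?N ^ 2) (?N ^ 3 / ?t) \<le> (C + 1) * ?N ^ 2"
      using K(2) C by (intro mult_mono) auto
    then show ?thesis .
  next
    case False
    then have "1 \<le> ?t / ?N" using N by simp
    moreover have "(C + 1) * (?t / ?N) = C * ?t / ?N + ?t / ?N" by (simp add: distrib_right add_divide_distrib)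
    ultimately have "real K \<le> (C + 1) * (?t / ?N)" using K(2) by linarith
    then have "real K * min (?N ^ 2) (?N ^ 3 / ?t) \<le> (C + 1) * (?t / ?N) * (?N ^ 3 / ?t)"
      using C by (intro mult_mono) auto
    also have "\<dots> = (C + 1) * ?N ^ 2"
      using N t by (simp add: power2_eq_square power3_eq_cube)
    finally show ?thesis .
  qed
  let ?b = "\<mu> / (12 * (C + 1)) * min (?N ^ 2) (?N ^ 3 / ?t)"
  have "12 * ?b * real K = \<mu> / (C + 1) * (real K * min (?N ^ 2) (?N ^ 3 / ?t))"
    using C by (simp add: field_simps)
  also have "\<dots> \<le> \<mu> / (C + 1) * ((C + 1) * ?N ^ 2)"
    using K_le C \<open>0 \<le> \<mu>\<close> by (intro mult_left_mono) auto
  also have "\<dots> = \<mu> * ?N ^ 2" using C by simp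
  also have "\<dots> \<le> real (card Q)" by (rule Q)
  finally have b: "12 * ?b * real K \<le> real (card Q)" .
  have Kpos: "0 < real K" by (simp add: K_def)
  have "ennreal ?b \<le> expected_queries A E nbr"
  proof (cases "K \<le> card Q")
    case True
    then have "1 \<le> card Q div K" using Kpos by (simp add: Suc_le_eq div_greater_zero_iff)
    \<comment> \<open>Rounding in \<open>card Q div K\<close> loses at most a factor 2, whence 12
      instead of 6.\<close>
    have "card Q < (card Q div K + 1) * K"
      using Kpos by (metis Suc_eq_plus1 dividend_less_div_times mult_Suc of_nat_0_less_iff add.commute)
    also have "\<dots> \<le> 2 * (card Q div K) * K"
      using \<open>1 \<le> card Q div K\<close> by (intro mult_right_mono) auto
    finally have "card Q \<le> 2 * (card Q div K) * K" by simp
    from of_nat_mono[where 'a = real, OF this]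
    have "real (card Q) \<le> 2 * real (card Q div K) * real K" by (simp only: of_nat_mult of_nat_numeral)
    with b have "12 * ?b * real K \<le> 2 * real (card Q div K) * real K" by linarith
    then have "12 * ?b \<le> 2 * real (card Q div K)" using Kpos by (simp only: mult_le_cancel_right_pos)
    then have "?b \<le> real (card Q div K) / 6" by linarith
    then show ?thesis using groups by (meson ennreal_leI order.trans)
  next
    case False
    with b have "12 * ?b * real K \<le> 1 * real K" by linarith
    then have "12 * ?b \<le> 1" using Kpos by (simp only: mult_le_cancel_right_pos)
    then have "?b \<le> 1 / 6" by linarith
    then show ?thesis
      using expected_queries_ge_one_sixth[OF A \<epsilon>(2) valid t] by (meson ennreal_leI order.trans)
  qed
  then show ?thesis by (simp only: C_def)
qed

end

section \<open>A sparse graph with prescribed parameters\<close>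

text \<open>Listing edges as increasing pairs turns edge and triangle counts into cardinalities of
  sets of tuples.\<close>

definition edges_of :: "(nat \<times> nat) set \<Rightarrow> nat set set" where
  "edges_of P = (\<lambda>(u, v). {u, v}) ` P"

lemma edges_of_iff:
  assumes "P \<subseteq> {(u, v). u < v}" "u < v"
  shows "{u, v} \<in> edges_of P \<longleftrightarrow> (u, v) \<in> P"
  using assms by (force simp: edges_of_def doubleton_eq_iff)

lemma card_edges_of:
  assumes "P \<subseteq> {(u, v). u < v}"
  shows "card (edges_of P) = card P"
  unfolding edges_of_def
proof (intro card_image inj_onI, clarify)
  fix u v u' v' assume "(u, v) \<in> P" "(u', v') \<in> P" and eq: "{u, v} = {u', v'}"
  then have "u < v" "u' < v'" using assms by auto
  with eq show "u = u' \<and> v = v'" by (auto simp: doubleton_eq_iff)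
qed

lemma card_3_sorted:
  fixes T :: "nat set"
  assumes "card T = 3"
  obtains u v w where "u < v" "v < w" "T = {u, v, w}"
proof -
  obtain x y z where T: "T = {x, y, z}" "x \<noteq> y" "y \<noteq> z" "x \<noteq> z"
    using assms by (auto simp: card_3_iff)
  then consider "x < y" "y < z" | "x < z" "z < y" | "y < x" "x < z"
    | "y < z" "z < x" | "z < x" "x < y" | "z < y" "y < x"
    by linarith
  then show ?thesis
    by cases (use T that in \<open>auto simp: insert_commute\<close>)
qed

lemma triangle_count_edges_of:
  assumes P: "P \<subseteq> {(u, v). u < v}"
  shows "triangle_count (edges_of P) = card {(u, v, w). (u, v) \<in> P \<and> (v, w) \<in> P \<and> (u, w) \<in> P}"
    (is "_ = card ?S")
proof -
  let ?f = "\<lambda>(u, v, w). {u, v, w}"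
  have S: "u < v \<and> v < w" if "(u, v, w) \<in> ?S" for u v w
    using that P by auto
  have "inj_on ?f ?S"
  proof (rule inj_onI, clarsimp)
    fix u v w u' v' w'
    assume "(u, v) \<in> P" "(v, w) \<in> P" "(u', v') \<in> P" "(v', w') \<in> P"
      and eq: "{u, v, w} = {u', v', w'}"
    then have lt: "u < v" "v < w" "u' < v'" "v' < w'" using P by auto
    from eq have "Min {u, v, w} = Min {u', v', w'}" "Max {u, v, w} = Max {u', v', w'}" by simp_all
    with lt have "u = u'" "w = w'" by auto
    with eq lt show "u = u' \<and> v = v' \<and> w = w'" by auto
  qed
  moreover have "?f ` ?S = triangles (edges_of P)"
  proof
    show "?f ` ?S \<subseteq> triangles (edges_of P)"
    proof (rule image_subsetI, clarify)
      fix u v w assume uvw: "(u, v) \<in> P" "(v, w) \<in> P" "(u, w) \<in> P"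
      then have "u < v" "v < w" using P by auto
      moreover have "{u, v} \<in> edges_of P" "{v, w} \<in> edges_of P" "{u, w} \<in> edges_of P"
        using uvw by (force simp: edges_of_def)+
      ultimately show "{u, v, w} \<in> triangles (edges_of P)"
        by (auto simp: triangles_def insert_commute)
    qed
    show "triangles (edges_of P) \<subseteq> ?f ` ?S"
    proof
      fix T assume T: "T \<in> triangles (edges_of P)"
      then have "card T = 3" by (simp add: triangles_def)
      then obtain u v w where uvw: "u < v" "v < w" "T = {u, v, w}" by (rule card_3_sorted)
      then have "{u, v} \<in> edges_of P" "{v, w} \<in> edges_of P" "{u, w} \<in> edges_of P"
        using T by (auto simp: triangles_def)
      then have "(u, v, w) \<in> ?S" using edges_of_iff[OF P] uvw by auto
      moreover have "T = ?f (u, v, w)" using uvw by simp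
      ultimately show "T \<in> ?f ` ?S" by blast
    qed
  qed
  ultimately show ?thesis using card_image[of ?f ?S] by (simp add: triangle_count_def)
qed

text \<open>The parts \<open>{1..b}\<close>, \<open>{b+1..2b}\<close>, \<open>{2b+1..3b}\<close> carry all edges from the first to the
  other two, and \<open>t div b\<close> edges between the latter, each closing \<open>b\<close> triangles. The vertex
  \<open>3b+1\<close> closes the remaining \<open>t mod b\<close> triangles, and the edges \<open>F\<close> from the first part to
  the vertices beyond \<open>3b+1\<close> pad the number of edges without closing any triangle.\<close>

lemma sparse_graph_exists:
  assumes b: "1 \<le> b" and t: "t \<le> b ^ 3" and m: "4 * b ^ 2 \<le> m"
    and n: "3 * b + 1 \<le> n" "m \<le> b * (n - (3 * b + 1))"
  obtains E where "simple_graph n E" "card E = m" "triangle_count E = t"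
    and "\<And>v. v \<in> {1..2 * b} \<Longrightarrow> b \<le> card {u\<in>{1..2 * b}. {u, v} \<in> E}"
    and "ordered_triangles E {1..2 * b} = {}"
proof -
  define q r where "q = t div b" and "r = t mod b"
  have r: "r < b" using b by (simp add: r_def)
  have "q \<le> b ^ 3 div b" unfolding q_def using t by (rule div_le_mono)
  \<comment> \<open>Thus \<open>q\<close> edges fit between the second and the third part.\<close>
  then have q: "q \<le> b ^ 2" using b by (simp add: power3_eq_cube power2_eq_square)
  let ?B = "{1..b}" and ?A = "{b + 1..2 * b}" and ?W = "{2 * b + 1..3 * b}" and ?Y = "{3 * b + 2..n}"
  have "q \<le> card (?A \<times> ?W)" using q by (simp add: card_cartesian_product power2_eq_square)
  then obtain S where S: "S \<subseteq> ?A \<times> ?W" "card S = q" "finite S"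
    by (rule obtain_subset_with_card_n)
  have "b \<le> b ^ 2" using b by (simp add: power2_eq_square)
  \<comment> \<open>Edges spent before padding: \<open>2 * b^2\<close> from the first part to the
    next two, \<open>r + 1\<close> at the vertex \<open>3 * b + 1\<close>, and the \<open>q\<close>
    edges of \<open>S\<close>.\<close>
  then have size: "2 * b ^ 2 + r + q + 1 \<le> m" using m q r by linarith
  have "m - (2 * b ^ 2 + r + q + 1) \<le> card (?B \<times> ?Y)"
    using n by (simp add: card_cartesian_product)
  then obtain F where F: "F \<subseteq> ?B \<times> ?Y" "card F = m - (2 * b ^ 2 + r + q + 1)" "finite F"
    by (rule obtain_subset_with_card_n)
  have SD: "b < x \<and> x \<le> 2 * b \<and> 2 * b < y \<and> y \<le> 3 * b" if "(x, y) \<in> S" for x y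
    using that S(1) by auto
  have FD: "1 \<le> x \<and> x \<le> b \<and> 3 * b + 1 < y \<and> y \<le> n" if "(x, y) \<in> F" for x y
    using that F(1) by auto
  \<comment> \<open>\<open>?X\<close> and \<open>?Z\<close> join \<open>3 * b + 1\<close> to the
    vertices up to \<open>r\<close> and to \<open>b + 1\<close>; its triangles are
    \<open>{u, b + 1, 3 * b + 1}\<close> with \<open>u \<le> r\<close>.\<close>
  let ?M = "?B \<times> {b + 1..3 * b}" and ?X = "{1..r} \<times> {3 * b + 1}" and ?Z = "{(b + 1, 3 * b + 1)}"
  define P where "P = ?M \<union> (?X \<union> (F \<union> (S \<union> ?Z)))"
  have P: "P \<subseteq> {(u, v). u < v}"
    using r b by (auto simp: P_def dest!: SD FD)
  define E where "E = edges_of P"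
  have "card P = card ?M + (card ?X + (card F + (card S + card ?Z)))"
    unfolding P_def
  proof (intro card_Un_disjoint[THEN trans] arg_cong2[of _ _ _ _ "(+)"] refl)
    show "?M \<inter> (?X \<union> (F \<union> (S \<union> ?Z))) = {}" "?X \<inter> (F \<union> (S \<union> ?Z)) = {}"
      "F \<inter> (S \<union> ?Z) = {}" "S \<inter> ?Z = {}"
      using r by (auto dest!: SD FD)
  qed (use S(3) F(3) in auto)
  also have "\<dots> = m"
    using size S(2) F(2) by (simp add: power2_eq_square)
  finally have card_E: "card E = m" using card_edges_of[OF P] by (simp add: E_def)
  have "{(u, v, w). (u, v) \<in> P \<and> (v, w) \<in> P \<and> (u, w) \<in> P} = ?B \<times> S \<union> {1..r} \<times> ?Z"
  proof (intro equalityI subsetI)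
    fix p assume "p \<in> {(u, v, w). (u, v) \<in> P \<and> (v, w) \<in> P \<and> (u, w) \<in> P}"
    then obtain u v w where p: "p = (u, v, w)" and uvw: "(u, v) \<in> P" "(v, w) \<in> P" "(u, w) \<in> P"
      by auto
    \<comment> \<open>No increasing edge ends in the first part, and the only ones that start beyond
      it are those of \<open>S\<close> and \<open>?Z\<close>.\<close>
    have "b < v" using uvw(1) by (auto simp: P_def dest!: SD FD)
    then have "(v, w) \<in> S \<or> (v, w) = (b + 1, 3 * b + 1)"
      using uvw(2) r by (auto simp: P_def dest!: FD)
    then show "p \<in> ?B \<times> S \<union> {1..r} \<times> ?Z"
    proof
      assume vw: "(v, w) \<in> S"
      then have "v \<le> 2 * b" using SD by auto
      then have "u \<in> ?B" using uvw(1) r by (auto simp: P_def dest!: SD FD)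
      then show ?thesis using vw p by simp
    next
      assume vw: "(v, w) = (b + 1, 3 * b + 1)"
      have "u < v" using uvw(1) P by auto
      then have "u \<in> {1..r}" using uvw(3) vw by (auto simp: P_def dest!: SD FD)
      then show ?thesis using vw p by simp
    qed
  next
    fix p assume "p \<in> ?B \<times> S \<union> {1..r} \<times> ?Z"
    then show "p \<in> {(u, v, w). (u, v) \<in> P \<and> (v, w) \<in> P \<and> (u, w) \<in> P}"
      using r b by (auto simp: P_def dest: SD)
  qed
  moreover have "card (?B \<times> S \<union> {1..r} \<times> ?Z) = card (?B \<times> S) + card ({1..r} \<times> ?Z)"
    using S by (intro card_Un_disjoint) auto
  moreover have "\<dots> = t"
    using S(2) by (simp add: card_cartesian_product q_def r_def)
  ultimately have "triangle_count E = t"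
    by (simp add: E_def triangle_count_edges_of[OF P])
  moreover have "simple_graph n E"
  proof -
    have "1 \<le> u \<and> v \<le> n" if "(u, v) \<in> P" for u v
      using that r n(1) by (auto simp: P_def dest!: SD FD)
    moreover have "u < v" if "(u, v) \<in> P" for u v
      using that P by auto
    ultimately show ?thesis
      unfolding simple_graph_def E_def edges_of_def by fastforce
  qed
  moreover have "b \<le> card {u\<in>{1..2 * b}. {u, v} \<in> E}" if "v \<in> {1..2 * b}" for v
  proof -
    have BA: "{x, y} \<in> E" "{y, x} \<in> E" if "x \<in> ?B" "y \<in> ?A" for x y
    proof -
      have "(x, y) \<in> P" using that by (auto simp: P_def)
      then show "{x, y} \<in> E" by (force simp: E_def edges_of_def)
      then show "{y, x} \<in> E" by (simp add: insert_commute)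
    qed
    show ?thesis
    proof (cases "v \<le> b")
      case True
      then have "?A \<subseteq> {u\<in>{1..2 * b}. {u, v} \<in> E}" using BA(2) that by auto
      from card_mono[OF _ this] show ?thesis by simp
    next
      case False
      then have "?B \<subseteq> {u\<in>{1..2 * b}. {u, v} \<in> E}" using BA(1) that by auto
      from card_mono[OF _ this] show ?thesis by simp
    qed
  qed
  moreover have "ordered_triangles E {1..2 * b} = {}"
  proof -
    \<comment> \<open>The first \<open>2 * b\<close> vertices induce a bipartite graph.\<close>
    have bip: "x \<le> b \<longleftrightarrow> \<not> y \<le> b" if "{x, y} \<in> E" "x \<le> 2 * b" "y \<le> 2 * b" for x y
    proof -
      have "(x, y) \<in> P \<or> (y, x) \<in> P"
        using that(1) by (auto simp: E_def edges_of_def doubleton_eq_iff)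
      then show ?thesis
        using that by (auto simp: P_def dest!: SD FD)
    qed
    have "(x, y, z) \<notin> ordered_triangles E {1..2 * b}" for x y z
      using bip[of x y] bip[of y z] bip[of x z] by (auto simp: ordered_triangles_def)
    then show ?thesis by auto
  qed
  ultimately show ?thesis using that card_E by blast
qed

section \<open>The lower bound\<close>

lemma card_edges_le_sum_degrees:
  assumes "simple_graph n E"
  shows "card E \<le> (\<Sum>v\<in>{1..n}. card {u\<in>{1..n}. {u, v} \<in> E})"
proof -
  let ?S = "SIGMA v:{1..n}. {u\<in>{1..n}. {u, v} \<in> E}"
  have "E \<subseteq> (\<lambda>(v, u). {v, u}) ` ?S"
  proof
    fix e assume "e \<in> E"
    moreover from this have "card e = 2" using assms by (simp add: simple_graph_def)
    then obtain u v where "e = {v, u}" by (auto simp: card_2_iff)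
    moreover have "(v, u) \<in> ?S"
      using simple_graphD[OF assms, of v u] calculation by (auto simp: insert_commute)
    ultimately show "e \<in> (\<lambda>(v, u). {v, u}) ` ?S" by force
  qed
  then have "card E \<le> card ?S" by (rule surj_card_le[rotated]) simp
  then show ?thesis by simp
qed

text \<open>The constant depends on \<open>\<epsilon>\<close> only. Graphs with
  \<open>n^2 \<le> 36 * m\<close> have density 1/36 on \<open>V = {1..n}\<close>, and the balanced
  complete bipartite graph of the sparse case is denser; \<open>\<delta>\<close> is the codegree
  threshold for \<open>\<alpha> = 1/36\<close>.\<close>

lemma dense_subset_lower_bound:
  fixes \<epsilon> \<delta> :: real
  assumes \<epsilon>: "0 < \<epsilon>" "\<epsilon> < 1" and \<delta>: "\<delta> = (1 / 36)\<^sup>2 / 2"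
  obtains c :: real where "0 < c"
    and "\<And>n E V t A. simple_graph n E \<Longrightarrow> V \<subseteq> {1..n} \<Longrightarrow> 8 \<le> \<delta> ^ 3 * real (card V)
      \<Longrightarrow> 1 / 36 * real (card V) ^ 2 \<le> (\<Sum>v\<in>V. real (card {u\<in>V. {u, v} \<in> E}))
      \<Longrightarrow> real (card (ordered_triangles E V)) \<le> \<delta> ^ 3 / 8 * real (card V) ^ 3
      \<Longrightarrow> triangle_count E = t \<Longrightarrow> 1 \<le> t
      \<Longrightarrow> computes_approximation n \<epsilon> (\<lambda>E. real (triangle_count E)) A
      \<Longrightarrow> \<exists>nbr. valid_input n E nbr
        \<and> ennreal (c * min (real (card V) ^ 2) (real (card V) ^ 3 / real t)) \<le> expected_queries A E nbr"
proof
  let ?c = "\<delta> ^ 4 / 320 / (12 * (2 * ((1 + \<epsilon>) / (1 - \<epsilon>)) / \<delta> + 1))"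
  have "0 < \<delta>" "\<delta> \<le> 1" by (simp_all add: \<delta> power2_eq_square)
  have "0 < 2 * ((1 + \<epsilon>) / (1 - \<epsilon>)) / \<delta> + 1"
    using \<epsilon> \<open>0 < \<delta>\<close> by (intro add_pos_pos divide_pos_pos mult_pos_pos) auto
  then show "0 < ?c" using \<open>0 < \<delta>\<close> by (intro divide_pos_pos mult_pos_pos) auto
  fix n E V t A
  assume E: "simple_graph n E" and V: "V \<subseteq> {1..n}" and N: "8 \<le> \<delta> ^ 3 * real (card V)"
    and dense: "1 / 36 * real (card V) ^ 2 \<le> (\<Sum>v\<in>V. real (card {u\<in>V. {u, v} \<in> E}))"
    and O: "real (card (ordered_triangles E V)) \<le> \<delta> ^ 3 / 8 * real (card V) ^ 3"
    and t: "triangle_count E = t" "1 \<le> t"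
    and A: "computes_approximation n \<epsilon> (\<lambda>E. real (triangle_count E)) A"
  have "finite V" using V finite_subset by blast
  have "V \<noteq> {}" using N by auto
  obtain nbr where nbr: "valid_input n E nbr" using valid_input_exists[OF E] by blast
  have "\<delta> * real (card V) ^ 2
      \<le> real (card {(a, c) \<in> V \<times> V. \<delta> * real (card V) \<le> real (card (common_nbrs E V a c))})"
    using many_pairs_with_large_codegree[OF \<open>finite V\<close> _ dense] unfolding \<delta> by simp
  from exchange_packing_exists[OF E V \<open>0 < \<delta>\<close> \<open>\<delta> \<le> 1\<close> N this O]
  obtain Q where Q: "exchange_packing n E V \<delta> Q" "\<delta> ^ 4 / 320 * real (card V) ^ 2 \<le> real (card Q)"
    by blast
  have "ennreal (?c * min (real (card V) ^ 2) (real (card V) ^ 3 / real (triangle_count E)))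
      \<le> expected_queries A E nbr"
    using exchange_packing.expected_queries_ge_min[OF Q(1) A \<epsilon> nbr _ \<open>V \<noteq> {}\<close> Q(2)] t by simp
  with nbr t show "\<exists>nbr. valid_input n E nbr
        \<and> ennreal (?c * min (real (card V) ^ 2) (real (card V) ^ 3 / real t)) \<le> expected_queries A E nbr"
    by blast
qed

theorem theorem4p7:
  fixes \<epsilon> :: real
  assumes "0 < \<epsilon>" and "\<epsilon> < 1"
  shows "\<exists>\<kappa>::real. \<kappa> > 0 \<and>
    (\<forall>(n::nat) (m::nat) (t::nat) (A::algorithm).
       t \<ge> 1 \<longrightarrow>
       (\<exists>E. simple_graph n E \<and> card E = m \<and> triangle_count E = t) \<longrightarrow>
       computes_approximation n \<epsilon> (\<lambda>E. real (triangle_count E)) A \<longrightarrow>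
       (\<exists>E nbr. valid_input n E nbr \<and> card E = m \<and> triangle_count E = t \<and>
          expected_queries A E nbr
            \<ge> ennreal (\<kappa> * min (real m) (real m powr (3 / 2) / real t))))"
proof -
  define \<delta> :: real where "\<delta> = (1 / 36)\<^sup>2 / 2"
  have \<delta>_pos: "0 < \<delta>" by (simp add: \<delta>_def)
  obtain c where c: "0 < c" and dense: "\<And>n E V t A. simple_graph n E \<Longrightarrow> V \<subseteq> {1..n}
      \<Longrightarrow> 8 \<le> \<delta> ^ 3 * real (card V)
      \<Longrightarrow> 1 / 36 * real (card V) ^ 2 \<le> (\<Sum>v\<in>V. real (card {u\<in>V. {u, v} \<in> E}))
      \<Longrightarrow> real (card (ordered_triangles E V)) \<le> \<delta> ^ 3 / 8 * real (card V) ^ 3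
      \<Longrightarrow> triangle_count E = t \<Longrightarrow> 1 \<le> t
      \<Longrightarrow> computes_approximation n \<epsilon> (\<lambda>E. real (triangle_count E)) A
      \<Longrightarrow> \<exists>nbr. valid_input n E nbr
        \<and> ennreal (c * min (real (card V) ^ 2) (real (card V) ^ 3 / real t)) \<le> expected_queries A E nbr"
    using dense_subset_lower_bound[OF assms \<delta>_def] by blast
  \<comment> \<open>The size of \<open>V\<close> from which the packing argument applies.\<close>
  define N0 where "N0 = 8 / \<delta> ^ 3"
  have N0: "8 \<le> \<delta> ^ 3 * x \<longleftrightarrow> N0 \<le> x" for x
    using \<delta>_pos by (simp add: N0_def field_simps)
  have N0_large: "8 \<le> N0"
  proof -
    have "\<delta> ^ 3 \<le> 1" using \<delta>_pos by (intro power_le_one) (auto simp: \<delta>_def power2_eq_square)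
    then show ?thesis using \<delta>_pos by (simp add: N0_def field_simps)
  qed
  \<comment> \<open>Bounds the minimum in the exceptional cases: too few vertices or edges,
    \<open>t\<close> of order \<open>n^3\<close> in a dense graph, \<open>t > b^3\<close> in the
    sparse case.\<close>
  define Z where "Z = max ((2 * N0 + 3) ^ 2) (max (216 / \<delta> ^ 3) 64)"
  \<comment> \<open>\<open>1 / (6 * Z)\<close> brings the exceptional cases below 1/6, and
    \<open>c / 8\<close> pays for replacing \<open>s\<close> by \<open>s / 2\<close> in a
    cube.\<close>
  define \<kappa> where "\<kappa> = min (1 / (6 * Z)) (c / 8)"
  have Z: "(2 * N0 + 3) ^ 2 \<le> Z" "216 / \<delta> ^ 3 \<le> Z" "64 \<le> Z" by (auto simp: Z_def)
  have \<kappa>: "0 < \<kappa>" "\<kappa> \<le> 1 / (6 * Z)" "\<kappa> \<le> c / 8" using Z(3) c by (auto simp: \<kappa>_def)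
  show ?thesis
  proof (intro exI[of _ \<kappa>] conjI \<kappa>(1) allI impI)
    fix n m t :: nat and A :: algorithm
    assume t: "t \<ge> 1" and "\<exists>E. simple_graph n E \<and> card E = m \<and> triangle_count E = t"
      and A: "computes_approximation n \<epsilon> (\<lambda>E. real (triangle_count E)) A"
    then obtain E where E: "simple_graph n E" "card E = m" "triangle_count E = t" by blast
    define s where "s = sqrt (real m)"
    have s: "0 \<le> s" "s ^ 2 = real m" by (simp_all add: s_def)
    have s3: "real m powr (3 / 2) = s ^ 3"
      by (cases "m = 0") (simp_all add: s_def powr_half_sqrt[symmetric] powr_powr flip: powr_realpow)
    let ?f = "min (real m) (s ^ 3 / real t)"
    let ?goal = "\<exists>E nbr. valid_input n E nbr \<and> card E = m \<and> triangle_count E = t \<and>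
          expected_queries A E nbr \<ge> ennreal (\<kappa> * ?f)"
    have f_nonneg: "0 \<le> ?f" using s by simp
    have trivial: ?goal if "?f \<le> Z"
    proof -
      have "\<kappa> * ?f \<le> 1 / (6 * Z) * Z"
        using \<kappa> that f_nonneg Z(3) by (intro mult_mono) auto
      then have "\<kappa> * ?f \<le> 1 / 6" using Z(3) by simp
      obtain nbr where nbr: "valid_input n E nbr" using valid_input_exists[OF E(1)] by blast
      have "ennreal (\<kappa> * ?f) \<le> ennreal (1 / 6)"
        using \<open>\<kappa> * ?f \<le> 1 / 6\<close> by (rule ennreal_leI)
      also have "\<dots> \<le> expected_queries A E nbr"
        using expected_queries_ge_one_sixth[OF A assms(2) nbr] E(3) t by simp
      finally show ?thesis using nbr E by blast
    qed
    have bound: "\<kappa> * ?f \<le> c * min (N ^ 2) (N ^ 3 / real t)" if "s / 2 \<le> N" for N :: real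
    proof -
      have "(s / 2) ^ 2 \<le> N ^ 2" "(s / 2) ^ 3 \<le> N ^ 3"
        using that s by (auto intro!: power_mono)
      then have "real m \<le> 8 * N ^ 2" "s ^ 3 / real t \<le> 8 * (N ^ 3 / real t)"
        using s t by (auto simp: power_divide field_simps)
      then have "?f \<le> 8 * min (N ^ 2) (N ^ 3 / real t)" by linarith
      then have "\<kappa> * ?f \<le> c / 8 * (8 * min (N ^ 2) (N ^ 3 / real t))"
        using \<kappa> f_nonneg c by (intro mult_mono) auto
      then show ?thesis by simp
    qed
    have ?goal
    \<comment> \<open>In the dense case \<open>E\<close> itself is the hard input, with
      \<open>V = {1..n}\<close>. Otherwise only the parameters of \<open>E\<close> are kept and a
      hard graph is built.\<close>
    proof (cases "n ^ 2 \<le> 36 * m")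
      case True
      have "m \<le> (\<Sum>v\<in>{1..n}. card {u\<in>{1..n}. {u, v} \<in> E})"
        using card_edges_le_sum_degrees[OF E(1)] E(2) by simp
      also have "\<dots> \<le> (\<Sum>v\<in>{1..n}. n)"
      proof (intro sum_mono)
        fix v
        have "card {u\<in>{1..n}. {u, v} \<in> E} \<le> card {1..n}" by (intro card_mono) auto
        then show "card {u\<in>{1..n}. {u, v} \<in> E} \<le> n" by simp
      qed
      finally have "m \<le> n ^ 2" by (simp add: power2_eq_square)
      from of_nat_mono[where 'a = real, OF this] have mn: "real m \<le> real n ^ 2" by simp
      then have "s ^ 2 \<le> real n ^ 2" by (simp only: s(2))
      then have sn: "s \<le> real n" by (rule power2_le_imp_le) simp
      show ?thesis
      proof (cases "N0 \<le> real n \<and> 27 * real t \<le> \<delta> ^ 3 / 8 * real n ^ 3")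
        case True
        have "real (n ^ 2) \<le> real (36 * m)" using \<open>n ^ 2 \<le> 36 * m\<close> by (rule of_nat_mono)
        then have "1 / 36 * real n ^ 2 \<le> real m" by simp
        also have "\<dots> \<le> (\<Sum>v\<in>{1..n}. real (card {u\<in>{1..n}. {u, v} \<in> E}))"
          using of_nat_mono[where 'a = real, OF card_edges_le_sum_degrees[OF E(1)]] E(2) by simp
        finally have "1 / 36 * real (card {1..n}) ^ 2
            \<le> (\<Sum>v\<in>{1..n}. real (card {u\<in>{1..n}. {u, v} \<in> E}))" by simp
        moreover have "real (card (ordered_triangles E {1..n})) \<le> \<delta> ^ 3 / 8 * real (card {1..n}) ^ 3"
          using True of_nat_mono[where 'a = real, OF card_ordered_triangles_le[OF E(1), of "{1..n}"]] E(3)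
          by simp
        moreover have "8 \<le> \<delta> ^ 3 * real (card {1..n})" using True by (simp add: N0)
        ultimately obtain nbr where nbr: "valid_input n E nbr"
          "ennreal (c * min (real n ^ 2) (real n ^ 3 / real t)) \<le> expected_queries A E nbr"
          using dense[OF E(1) order.refl _ _ _ E(3) t A] by auto
        have "s / 2 \<le> real n" using sn s(1) by simp
        from ennreal_leI[OF bound[OF this]] nbr(2)
        have "ennreal (\<kappa> * ?f) \<le> expected_queries A E nbr" by (rule order.trans)
        with nbr(1) E show ?thesis by blast
      next
        case False
        have "?f \<le> Z"
        proof (cases "N0 \<le> real n")
          \<comment> \<open>Here \<open>t\<close> has order at least \<open>n^3\<close>, so
            \<open>s^3 / t\<close> is bounded; 216 is \<open>27 * 8\<close>, from the ordered
            triangles and from \<open>\<delta>^3 / 8\<close>.\<close>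
          case True
          then have "\<delta> ^ 3 * real n ^ 3 < 216 * real t" using False by simp
          moreover have "\<delta> ^ 3 * s ^ 3 \<le> \<delta> ^ 3 * real n ^ 3"
            using sn s \<delta>_pos by (intro mult_left_mono power_mono) auto
          ultimately have "\<delta> ^ 3 * s ^ 3 \<le> 216 * real t" by linarith
          then have "s ^ 3 / real t \<le> 216 / \<delta> ^ 3"
            using t \<delta>_pos by (simp add: field_simps)
          then show ?thesis using Z(2) by linarith
        next
          case False
          then have "real n ^ 2 \<le> (2 * N0 + 3) ^ 2" using N0_large by (intro power_mono) auto
          then show ?thesis using mn Z(1) by linarith
        qed
        then show ?thesis by (rule trivial)
      qed
    next
      case False
      \<comment> \<open>\<open>3 * b \<le> s\<close> keeps \<open>4 * b^2\<close> below
        \<open>m\<close>. For the padding, \<open>n \<ge> 6 * s\<close> leaves \<open>4 * s\<close>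
        vertices beyond the core, and \<open>b \<ge> s / 4\<close> edges can go to each.\<close>
      define b where "b = nat \<lfloor>s / 3\<rfloor>"
      have b: "real b \<le> s / 3" "s / 3 < real b + 1" using s(1) unfolding b_def by linarith+
      have "real (36 * m) \<le> real (n ^ 2)" using False by (intro of_nat_mono) simp
      then have "(6 * s) ^ 2 \<le> real n ^ 2" using s by (simp add: power_mult_distrib)
      then have ns: "6 * s \<le> real n" by (rule power2_le_imp_le) simp
      show ?thesis
      proof (cases "N0 \<le> 2 * real b \<and> t \<le> b ^ 3")
        case True
        then have b4: "4 \<le> real b" using N0_large by linarith
        have bs: "s / 4 \<le> real b" using b b4 by linarith
        have b1: "1 \<le> b" using b4 by linarith
        have m4: "4 * b ^ 2 \<le> m"
        proof -
          have "real b ^ 2 \<le> (s / 3) ^ 2" using b by (intro power_mono) auto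
          then have "4 * real b ^ 2 \<le> real m" using s by (simp add: power_divide)
          then have "real (4 * b ^ 2) \<le> real m" by simp
          then show ?thesis by (simp only: of_nat_le_iff)
        qed
        have n: "3 * b + 1 \<le> n"
        proof -
          have "real (3 * b + 1) \<le> real n" using b ns b4 by simp
          then show ?thesis by (simp only: of_nat_le_iff)
        qed
        have nm: "m \<le> b * (n - (3 * b + 1))"
        proof -
          have "4 * s \<le> real (n - (3 * b + 1))" using n b ns b4 by (simp add: of_nat_diff)
          then have "(s / 4) * (4 * s) \<le> real b * real (n - (3 * b + 1))"
            using bs s by (intro mult_mono) auto
          then have "real m \<le> real (b * (n - (3 * b + 1)))"
            using s(2) by (simp add: power2_eq_square)
          then show ?thesis by (simp only: of_nat_le_iff)
        qed
        have tb: "t \<le> b ^ 3" using True by simp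
        obtain E' where E': "simple_graph n E'" "card E' = m" "triangle_count E' = t"
          and deg: "\<And>v. v \<in> {1..2 * b} \<Longrightarrow> b \<le> card {u\<in>{1..2 * b}. {u, v} \<in> E'}"
          and no_tri: "ordered_triangles E' {1..2 * b} = {}"
          by (rule sparse_graph_exists[OF b1 tb m4 n nm]) (rule that)
        have "(\<Sum>v\<in>{1..2 * b}. real b) \<le> (\<Sum>v\<in>{1..2 * b}. real (card {u\<in>{1..2 * b}. {u, v} \<in> E'}))"
          using deg by (intro sum_mono of_nat_mono)
        moreover have "1 / 36 * (2 * real b) ^ 2 \<le> (\<Sum>v\<in>{1..2 * b}. real b)"
          by (simp add: power2_eq_square)
        ultimately have "1 / 36 * real (card {1..2 * b}) ^ 2
            \<le> (\<Sum>v\<in>{1..2 * b}. real (card {u\<in>{1..2 * b}. {u, v} \<in> E'}))" by simp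
        moreover have "real (card (ordered_triangles E' {1..2 * b})) \<le> \<delta> ^ 3 / 8 * real (card {1..2 * b}) ^ 3"
          unfolding no_tri using \<delta>_pos by simp
        moreover have "{1..2 * b} \<subseteq> {1..n}" using n by auto
        moreover have "8 \<le> \<delta> ^ 3 * real (card {1..2 * b})" using True by (simp add: N0)
        ultimately obtain nbr where nbr: "valid_input n E' nbr"
          "ennreal (c * min ((2 * real b) ^ 2) ((2 * real b) ^ 3 / real t)) \<le> expected_queries A E' nbr"
          using dense[OF E'(1) _ _ _ _ E'(3) t A, of "{1..2 * b}"] by auto
        have "s / 2 \<le> 2 * real b" using bs by simp
        from ennreal_leI[OF bound[OF this]] nbr(2)
        have "ennreal (\<kappa> * ?f) \<le> expected_queries A E' nbr" by (rule order.trans)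
        with nbr(1) E' show ?thesis by blast
      next
        case False
        have "?f \<le> Z"
        proof (cases "N0 \<le> 2 * real b")
          \<comment> \<open>Here \<open>t\<close> exceeds what the construction can hold; with
            \<open>s \<le> 4 * b\<close> this gives \<open>s^3 / t \<le> 64\<close>.\<close>
          case True
          then have "b ^ 3 \<le> t" "4 \<le> real b" using False N0_large by auto
          then have "real b ^ 3 \<le> real t" by (metis of_nat_mono of_nat_power)
          moreover have "(s / 4) ^ 3 \<le> real b ^ 3"
            using b \<open>4 \<le> real b\<close> s by (intro power_mono) auto
          moreover have "s ^ 3 = 64 * (s / 4) ^ 3" by (simp add: power_divide)
          ultimately have "s ^ 3 \<le> 64 * real t" by linarith
          then have "s ^ 3 / real t \<le> 64" using t by (simp add: field_simps)
          then show ?thesis using Z(3) by linarith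
        next
          case False
          \<comment> \<open>From \<open>s < 3 * (b + 1)\<close> and
            \<open>2 * b < N0\<close>.\<close>
          then have "s \<le> 2 * N0 + 3" using b by linarith
          then have "s ^ 2 \<le> (2 * N0 + 3) ^ 2" using s by (intro power_mono) auto
          then show ?thesis using s Z(1) by linarith
        qed
        then show ?thesis by (rule trivial)
      qed
    qed
    then show "\<exists>E nbr. valid_input n E nbr \<and> card E = m \<and> triangle_count E = t \<and>
          expected_queries A E nbr \<ge> ennreal (\<kappa> * min (real m) (real m powr (3 / 2) / real t))"
      by (simp only: s3)
  qed
qed

end
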